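(* Let $K$ be an imaginary quadratic field, $\mathcal{O}$ an order in $K$ of discriminant $D_\mathcal{O}$, $N$ a positive integer and $G$ a subgroup of $(\mathbb{Z}/N\mathbb{Z})^\times$. Then the map $$\psi_{\Gamma_G,\,P_G(\mathcal{O},N)}:\ \mathcal{C}_{\Gamma_G}(D_\mathcal{O},N)\rightarrow I(\mathcal{O},N)/P_G(\mathcal{O},N),\qquad [Q]\mapsto[[\omega_Q,1]]$$ is a well-defined bijection, and hence the group $\Gamma_G$ induces a form class group of level $N$.
   Context: A proper fractional $\mathcal{O}$-ideal is an invertible fractional $\mathcal{O}$-ideal; $I(\mathcal{O})$ is the group of these. A nonzero ideal $\mathfrak{a}$ of $\mathcal{O}$ is prime to a positive integer $\ell$ if $\mathfrak{a}+\ell\mathcal{O}=\mathcal{O}$. $I(\mathcal{O},N)$ is the subgroup of $I(\mathcal{O})$ generated by the nonzero proper $\mathcal{O}$-ideals contained in $\mathcal{O}$ and prime to $N$. $P(\mathcal{O},N)$ is the subgroup of $I(\mathcal{O},N)$ generated by the $\nu\mathcal{O}$ with $\nu\in\mathcal{O}\setminus\{0\}$ and $\nu\mathcal{O}$ prime to $N$. For a subgroup $G$ of $(\mathbb{Z}/N\mathbb{Z})^\times$, $P_G(\mathcal{O},N)$ is the subgroup generated by the $\nu\mathcal{O}$ with $\nu\in\mathcal{O}\setminus\{0\}$ and $\nu\equiv t\pmod{N\mathcal{O}}$ for some $t\in\mathbb{Z}$ with $t+N\mathbb{Z}\in G$. $\mathcal{Q}(D_\mathcal{O},N)=\{ax^2+bxy+cy^2\in\mathbb{Z}[x,y]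 : \gcd(a,b,c)=\gcd(a,N)=1,\ b^2-4ac=D_\mathcal{O},\ a>0\}$. For $Q=ax^2+bxy+cy^2$ in this set, $\omega_Q=\frac{-b+\sqrt{D_\mathcal{O}}}{2a}$ (in the upper half-plane), and $[\omega_Q,1]=\mathbb{Z}\omega_Q+\mathbb{Z}$, which belongs to $I(\mathcal{O},N)$. For $\gamma\in\mathrm{SL}_2(\mathbb{Z})$, $Q^\gamma\left(\begin{bmatrix}x\\ y\end{bmatrix}\right)=Q\left(\gamma\begin{bmatrix}x\\ y\end{bmatrix}\right)$. For a subgroup $\Gamma$ of $\mathrm{SL}_2(\mathbb{Z})$ containing the principal congruence subgroup $\Gamma(N)$, define $Q\sim_\Gamma Q'$ on $\mathcal{Q}(D_\mathcal{O},N)$ iff $Q'=Q^\gamma$ for some $\gamma\in\Gamma$, and $\mathcal{C}_\Gamma(D_\mathcal{O},N)=\mathcal{Q}(D_\mathcal{O},N)/\sim_\Gamma$. $\Gamma_G=\left\{\gamma\in\mathrm{SL}_2(\mathbb{Z}) : \gamma\equiv\begin{bmatrix}t&*\\ 0&*\end{bmatrix}\pmod{NM_2(\mathbb{Z})}\text{ for some integer }t\text{ with }t+N\mathbb{Z}\in G\right\}$, and $\Gamma_1(N)=\left\{\gamma\in\mathrm{SL}_2(\mathbb{Z}):\gamma\equiv\begin{bmatrix}1&*\\ 0&1\end{bmatrix}\pmod{NM_2(\mathbb{Z})}\right\}$. "$\Gamma$ induces a form class group of level $N$" means: (i) $\Gamma\supseteq\Gamma_1(N)$; (ii) there is a subgroup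 $P$ of $P(\mathcal{O},N)$ containing $P_{\{1+N\mathbb{Z}\}}(\mathcal{O},N)$ such that $\psi_{\Gamma,P}:\mathcal{C}_\Gamma(D_\mathcal{O},N)\to I(\mathcal{O},N)/P$, $[Q]\mapsto[[\omega_Q,1]]$, is a well-defined bijection. *)

theory Defs
  imports
    "HOL-Analysis.Determinants"
    "HOL-Number_Theory.Cong"
    "HOL-Algebra.Generated_Groups"
    "HOL-Algebra.IntRing"
    "HOL-Algebra.Algebraic_Closure_Type"
begin

section \<open>Imaginary quadratic fields and their orders\<close>

text \<open>
  Number fields are taken inside the complex numbers, as the roots \<open>\<omega>\<^sub>Q\<close> in the upper
  half-plane are. The two interpretations provide the \<open>\<rat>\<close>-span and \<open>\<rat>\<close>-dimension
  (\<open>rat_vs.span\<close>, \<open>rat_vs.dim\<close>) and the \<open>\<int>\<close>-span (\<open>int_mod.span\<close>) of sets of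
  complex numbers.
\<close>

global_interpretation rat_vs: Vector_Spaces.vector_space "\<lambda>(q::rat) (z::complex). of_rat q * z"
  by unfold_locales (simp_all add: of_rat_add of_rat_mult algebra_simps)

global_interpretation int_mod: Modules.module "\<lambda>(n::int) (z::complex). of_int n * z"
  by unfold_locales (simp_all add: algebra_simps)

abbreviation complex_ring :: "complex ring"
  where "complex_ring \<equiv> ring_of_type_algebra"

definition imaginary_quadratic_field :: "complex set \<Rightarrow> bool" where
  "imaginary_quadratic_field K \<longleftrightarrow>
     subfield K complex_ring \<and> rat_vs.dim K = 2 \<and> \<not> K \<subseteq> \<real>"

text \<open>
  An order of \<open>K\<close>: a subring (with 1) of \<open>K\<close> that is finitely generated as an abelian group
  and contains a \<open>\<rat>\<close>-basis of \<open>K\<close>.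
\<close>

definition is_order :: "complex set \<Rightarrow> complex set \<Rightarrow> bool" where
  "is_order K R \<longleftrightarrow>
     subring R complex_ring \<and> R \<subseteq> K \<and>
     (\<exists>S. finite S \<and> R = int_mod.span S) \<and> rat_vs.span R = K"

text \<open>
  The discriminant of a \<open>\<int>\<close>-basis \<open>\<alpha>, \<beta>\<close> of the order is the square of the determinant of the
  conjugates; complex conjugation restricts to the nontrivial automorphism of \<open>K\<close>. Two generators
  of an order, which has rank 2, always form a \<open>\<int>\<close>-basis.
\<close>

definition order_discriminant :: "complex set \<Rightarrow> int" where
  "order_discriminant R =
     (THE D. \<exists>\<alpha> \<beta>. R = int_mod.span {\<alpha>, \<beta>} \<and> of_int D = (\<alpha> * cnj \<beta> - cnj \<alpha> * \<beta>)\<^sup>2)"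


section \<open>Fractional ideals and class groups\<close>

definition fractional_ideal :: "complex set \<Rightarrow> complex set \<Rightarrow> complex set \<Rightarrow> bool" where
  "fractional_ideal K R A \<longleftrightarrow>
     A \<subseteq> K \<and> int_mod.subspace A \<and> A \<noteq> {0} \<and> (\<forall>r\<in>R. \<forall>x\<in>A. r * x \<in> A) \<and>
     (\<exists>d\<in>R - {0}. \<forall>x\<in>A. d * x \<in> R)"

definition ideal_times :: "complex set \<Rightarrow> complex set \<Rightarrow> complex set" where
  "ideal_times A B = int_mod.span {x * y | x y. x \<in> A \<and> y \<in> B}"

definition proper_fractional_ideal :: "complex set \<Rightarrow> complex set \<Rightarrow> complex set \<Rightarrow> bool" where
  "proper_fractional_ideal K R A \<longleftrightarrow>
     fractional_ideal K R A \<and> (\<exists>B. fractional_ideal K R B \<and> ideal_times A B = R)"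

definition ideal_group :: "complex set \<Rightarrow> complex set \<Rightarrow> complex set monoid" where
  "ideal_group K R = \<lparr>carrier = {A. proper_fractional_ideal K R A}, mult = ideal_times, one = R\<rparr>"

definition prime_to :: "complex set \<Rightarrow> nat \<Rightarrow> complex set \<Rightarrow> bool" where
  "prime_to R l A \<longleftrightarrow> {x + of_nat l * y | x y. x \<in> A \<and> y \<in> R} = R"

definition principal_ideal :: "complex set \<Rightarrow> complex \<Rightarrow> complex set" where
  "principal_ideal R \<nu> = {\<nu> * x | x. x \<in> R}"

text \<open>\<open>I(R, N)\<close>, as a group\<close>

definition ideal_group_prime_to :: "complex set \<Rightarrow> complex set \<Rightarrow> nat \<Rightarrow> complex set monoid" where
  "ideal_group_prime_to K R N =
     (ideal_group K R)\<lparr>carrier :=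
        generate (ideal_group K R)
          {A. proper_fractional_ideal K R A \<and> A \<subseteq> R \<and> prime_to R N A}\<rparr>"

text \<open>\<open>P(R, N)\<close>\<close>

definition principal_prime_to :: "complex set \<Rightarrow> complex set \<Rightarrow> nat \<Rightarrow> complex set set" where
  "principal_prime_to K R N =
     generate (ideal_group_prime_to K R N)
       {principal_ideal R \<nu> | \<nu>. \<nu> \<in> R - {0} \<and> prime_to R N (principal_ideal R \<nu>)}"

text \<open>
  The residue class \<open>t + N\<int>\<close> as an element of the quotient ring \<open>ZFact N\<close>. The group
  \<open>(\<int>/N\<int>)\<^sup>\<times>\<close> is \<open>units_of (ZFact N)\<close>, which for \<open>N = 1\<close> is the trivial group.
\<close>

definition residue_class :: "nat \<Rightarrow> int \<Rightarrow> int set" where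
  "residue_class N t = (Idl\<^bsub>\<Z>\<^esub> {int N}) +>\<^bsub>\<Z>\<^esub> t"

text \<open>\<open>P\<^sub>G(R, N)\<close>\<close>

definition principal_in ::
  "complex set \<Rightarrow> complex set \<Rightarrow> nat \<Rightarrow> int set set \<Rightarrow> complex set set" where
  "principal_in K R N G =
     generate (ideal_group_prime_to K R N)
       {principal_ideal R \<nu> | \<nu>. \<nu> \<in> R - {0} \<and>
          (\<exists>t. residue_class N t \<in> G \<and> (\<exists>y\<in>R. \<nu> - of_int t = of_nat N * y))}"


section \<open>Binary quadratic forms\<close>

text \<open>The triple \<open>(a, b, c)\<close> stands for the form \<open>a x\<^sup>2 + b x y + c y\<^sup>2\<close>.\<close>

type_synonym form = "int \<times> int \<times> int"

fun form_eval :: "form \<Rightarrow> int^2 \<Rightarrow> int" where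
  "form_eval (a, b, c) v = a * (v$1)\<^sup>2 + b * (v$1) * (v$2) + c * (v$2)\<^sup>2"

fun form_act :: "form \<Rightarrow> int^2^2 \<Rightarrow> form" where
  "form_act (a, b, c) \<gamma> =
     (let p = \<gamma>$1$1; q = \<gamma>$1$2; r = \<gamma>$2$1; s = \<gamma>$2$2 in
        (a * p\<^sup>2 + b * p * r + c * r\<^sup>2,
         2 * a * p * q + b * (p * s + q * r) + 2 * c * r * s,
         a * q\<^sup>2 + b * q * s + c * s\<^sup>2))"

lemma form_eval_act: "form_eval (form_act Q \<gamma>) v = form_eval Q (\<gamma> *v v)"
  by (cases Q) (simp add: Let_def matrix_vector_mult_def sum_2 power2_eq_square algebra_simps)

lemma form_eval_inject:
  assumes "\<And>v. form_eval Q v = form_eval Q' v"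
  shows "Q = Q'"
proof -
  obtain a b c a' b' c' where "Q = (a, b, c)" "Q' = (a', b', c')"
    by (metis prod_cases3)
  then show ?thesis
    using assms[of "vector [1, 0]"] assms[of "vector [0, 1]"] assms[of "vector [1, 1]"]
    by simp
qed

definition forms :: "int \<Rightarrow> nat \<Rightarrow> form set" where
  "forms D N = {(a, b, c). gcd a (gcd b c) = 1 \<and> gcd a (int N) = 1 \<and> b\<^sup>2 - 4 * a * c = D \<and> a > 0}"

text \<open>For \<open>D < 0\<close>, \<open>csqrt D\<close> is the square root of \<open>D\<close> with positive imaginary part.\<close>

fun form_root :: "int \<Rightarrow> form \<Rightarrow> complex" where
  "form_root D (a, b, c) = (- of_int b + csqrt (of_int D)) / (2 * of_int a)"

definition form_lattice :: "int \<Rightarrow> form \<Rightarrow> complex set" where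
  "form_lattice D Q = int_mod.span {form_root D Q, 1}"


section \<open>Congruence subgroups and form classes\<close>

definition SL2Z :: "(int^2^2) monoid" where
  "SL2Z = \<lparr>carrier = {\<gamma>. det \<gamma> = 1}, mult = (**), one = mat 1\<rparr>"

definition Gamma1 :: "nat \<Rightarrow> (int^2^2) set" where
  "Gamma1 N = {\<gamma> \<in> carrier SL2Z.
     [\<gamma>$1$1 = 1] (mod int N) \<and> [\<gamma>$2$1 = 0] (mod int N) \<and> [\<gamma>$2$2 = 1] (mod int N)}"

definition Gamma_in :: "nat \<Rightarrow> int set set \<Rightarrow> (int^2^2) set" where
  "Gamma_in N G = {\<gamma> \<in> carrier SL2Z.
     \<exists>t. residue_class N t \<in> G \<and> [\<gamma>$1$1 = t] (mod int N) \<and> [\<gamma>$2$1 = 0] (mod int N)}"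

definition form_rel :: "int \<Rightarrow> nat \<Rightarrow> (int^2^2) set \<Rightarrow> (form \<times> form) set" where
  "form_rel D N \<Gamma> =
     {(Q, Q'). Q \<in> forms D N \<and> Q' \<in> forms D N \<and> (\<exists>\<gamma>\<in>\<Gamma>. Q' = form_act Q \<gamma>)}"

definition form_classes :: "int \<Rightarrow> nat \<Rightarrow> (int^2^2) set \<Rightarrow> form set set" where
  "form_classes D N \<Gamma> = forms D N // form_rel D N \<Gamma>"


section \<open>The map from form classes to ideal classes\<close>

definition form_ideal_class ::
  "complex set \<Rightarrow> complex set \<Rightarrow> nat \<Rightarrow> complex set set \<Rightarrow> form \<Rightarrow> complex set set" where
  "form_ideal_class K R N P Q =
     P #>\<^bsub>ideal_group_prime_to K R N\<^esub> form_lattice (order_discriminant R) Q"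

definition psi ::
  "complex set \<Rightarrow> complex set \<Rightarrow> nat \<Rightarrow> complex set set \<Rightarrow> form set \<Rightarrow> complex set set" where
  "psi K R N P C = the_elem (form_ideal_class K R N P ` C)"

text \<open>
  Well-definedness comprises that \<open>\<sim>\<^sub>\<Gamma>\<close> is an equivalence relation, that \<open>I(R, N)/P\<close> is a
  quotient group, that the lattices \<open>[\<omega>\<^sub>Q, 1]\<close> lie in \<open>I(R, N)\<close> and that their classes
  depend only on the class of \<open>Q\<close>.
\<close>

definition psi_well_defined_bij ::
  "complex set \<Rightarrow> complex set \<Rightarrow> nat \<Rightarrow> (int^2^2) set \<Rightarrow> complex set set \<Rightarrow> bool" where
  "psi_well_defined_bij K R N \<Gamma> P \<longleftrightarrow>
     (let D = order_discriminant R; I = ideal_group_prime_to K R N in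
        equiv (forms D N) (form_rel D N \<Gamma>) \<and>
        group I \<and> P \<lhd> I \<and>
        (\<forall>Q\<in>forms D N. form_lattice D Q \<in> carrier I) \<and>
        (form_ideal_class K R N P) respects (form_rel D N \<Gamma>) \<and>
        bij_betw (psi K R N P) (form_classes D N \<Gamma>) (carrier (I Mod P)))"

definition induces_form_class_group ::
  "complex set \<Rightarrow> complex set \<Rightarrow> nat \<Rightarrow> (int^2^2) set \<Rightarrow> bool" where
  "induces_form_class_group K R N \<Gamma> \<longleftrightarrow>
     subgroup \<Gamma> SL2Z \<and> Gamma1 N \<subseteq> \<Gamma> \<and>
     (\<exists>P. subgroup P ((ideal_group_prime_to K R N)\<lparr>carrier := principal_prime_to K R N\<rparr>) \<and>
          principal_in K R N {residue_class N 1} \<subseteq> P \<and>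
          psi_well_defined_bij K R N \<Gamma> P)"

end

theory Submission
  imports Defs
begin

text \<open>
  If \<open>Q' = Q\<^sup>\<gamma>\<close> and \<open>\<gamma>\<close> has lower row \<open>(r, s)\<close>, then \<open>[\<omega>\<^sub>Q\<^sub>', 1] = (r \<omega>\<^sub>Q\<^sub>' + s) [\<omega>\<^sub>Q, 1]\<close>, and
  \<open>r \<omega>\<^sub>Q\<^sub>' + s\<close> is congruent to \<open>s\<close> modulo \<open>N\<close> up to an integer factor congruent to 1; this gives
  well-definedness. Conversely, a homothety of the two lattices is a unimodular change of basis, and
  comparing coordinates modulo \<open>N\<close> shows that its matrix lies in \<open>\<Gamma>\<^sub>G\<close>. For surjectivity, an ideal
  \<open>A\<close> in \<open>I(\<O>, N)\<close> has, up to an integer factor congruent to 1, a \<open>\<int>\<close>-basis \<open>\<eta>, \<xi>\<close> with \<open>\<xi>\<close>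
  congruent to 1 modulo \<open>N\<close>, so that \<open>\<omega> = \<eta> / \<xi>\<close> is the root of a form in the class of \<open>A\<close>. No
  ideal factorisation is needed: \<open>I(\<O>, N)\<close> consists of the invertible ideals \<open>A\<close> with
  \<open>m \<in> A\<close> and \<open>m A \<subseteq> \<O>\<close> for some positive integer \<open>m\<close> congruent to 1 modulo \<open>N\<close>, and \<open>P\<^sub>G(\<O>, N)\<close> of the
  \<open>(\<nu> / n) \<O>\<close> with \<open>\<nu>\<close> and \<open>n\<close> congruent to elements of \<open>G\<close>.
\<close>

section \<open>Lattices in the complex plane\<close>

text \<open>Since \<open>I(\<O>, N)\<close> and \<open>P\<^sub>G(\<O>, N)\<close> are defined by
  generators, membership in them cannot be tested directly, and this shapes the proof. Norms provide
  the tests: an ideal containing an element x of \<O> also contains \<open>x * cnj x\<close>, an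
  integer congruent to t^2 modulo N whenever x is congruent to t. With t = 1 this produces the
  integers m of the overview. The same norm inverts \<nu> / n as
  \<open>n * cnj \<nu> / (\<nu> * cnj \<nu>)\<close>, so integer denominators suffice. The passage
  from lattices back to forms rests on multiplier rings. If \<omega> is a root of a primitive form
  (a, b, c), the lattice [\<omega>, 1] is multiplied into itself exactly by [a \<omega>, 1]; for an
  invertible ideal these multipliers are exactly \<O>. Equating the two rings forces the form to
  have the discriminant of \<O>. That a is prime to N then says that some integer congruent to 1
  carries [\<omega>, 1] into \<O>. Determinants of base changes are a priori 1 or -1; keeping all
  roots in the upper half-plane excludes -1.\<close>

lemma span_pair_iff: "z \<in> int_mod.span {x, y} \<longleftrightarrow> (\<exists>i j. z = of_int i * x + of_int j * y)"
  unfolding int_mod.span_breakdown_eq int_mod.span_empty by (force simp: algebra_simps)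

lemma span_pairI: "of_int i * x + of_int j * y \<in> int_mod.span {x, y}"
  using span_pair_iff by blast

lemma span_uminus_left: "int_mod.span {- x, y} = int_mod.span {x, y}"
proof -
  have "int_mod.span {- x, y} \<subseteq> int_mod.span {x, y}" for x y
    by (intro int_mod.span_minimal) (auto intro: int_mod.span_base int_mod.span_neg)
  from this[of x y] this[of "- x" y] show ?thesis by auto
qed

lemma int_subspaceI:
  assumes "0 \<in> A" and "\<And>x y. x \<in> A \<Longrightarrow> y \<in> A \<Longrightarrow> x - y \<in> A"
  shows "int_mod.subspace A"
proof -
  have neg: "- x \<in> A" if "x \<in> A" for x
    using assms(2)[OF assms(1) that] by simp
  have add: "x + y \<in> A" if "x \<in> A" "y \<in> A" for x y
    using assms(2)[OF that(1) neg[OF that(2)]] by simp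
  have nat: "of_nat n * x \<in> A" if "x \<in> A" for x n
    by (induction n) (auto simp: assms(1) distrib_right intro: add that)
  have "of_int n * x \<in> A" if "x \<in> A" for x n
    using nat[OF that, of "nat n"] neg[OF nat[OF that, of "nat (-n)"]]
    by (cases "n \<ge> 0") auto
  with assms(1) add show ?thesis
    by (simp add: int_mod.subspace_def)
qed

text \<open>Subgroups of \<int> are principal: division with remainder by the least positive
  element. The zero subgroup has the generator 0, so no rank condition has to be carried
  along.\<close>

lemma int_subgroup_dvd:
  fixes J :: "int set"
  assumes "0 \<in> J" and diff: "\<And>x y. x \<in> J \<Longrightarrow> y \<in> J \<Longrightarrow> x - y \<in> J"
  shows "\<exists>g. J = {k. g dvd k}"
proof (cases "J = {0}")
  case True
  then show ?thesis by (intro exI[of _ 0]) auto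
next
  case False
  have neg: "- x \<in> J" if "x \<in> J" for x
    using diff[OF assms(1) that] by simp
  have add: "x + y \<in> J" if "x \<in> J" "y \<in> J" for x y
    using diff[OF that(1) neg[OF that(2)]] by simp
  have nat: "int n * x \<in> J" if "x \<in> J" for x n
    by (induction n) (auto simp: assms(1) distrib_right intro: add that)
  have mult: "n * x \<in> J" if "x \<in> J" for x n
    using nat[OF that, of "nat n"] neg[OF nat[OF that, of "nat (-n)"]]
    by (cases "n \<ge> 0") auto
  from False assms(1) obtain x where "x \<in> J" "x \<noteq> 0" by auto
  then have ex: "\<exists>n>0. int n \<in> J"
    using neg[of x] by (intro exI[of _ "nat \<bar>x\<bar>"]) (auto simp: abs_if)
  define g where "g = (LEAST n. n > 0 \<and> int n \<in> J)"
  have "g > 0 \<and> int g \<in> J" unfolding g_def by (rule LeastI_ex[OF ex])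
  then have g: "g > 0" "int g \<in> J" by auto
  have "int g dvd k" if "k \<in> J" for k
  proof (rule ccontr)
    assume "\<not> int g dvd k"
    then have "k mod int g \<noteq> 0" by (simp only: dvd_eq_mod_eq_0 not_False_eq_True)
    moreover have "k mod int g \<ge> 0" using g(1) by simp
    ultimately have pos: "k mod int g > 0" by linarith
    have "k - (k div int g) * int g \<in> J" by (intro diff that mult g)
    then have "int (nat (k mod int g)) \<in> J"
      using pos by (simp add: minus_div_mult_eq_mod)
    moreover have "nat (k mod int g) < g"
      using g(1) pos by (simp add: nat_less_iff)
    ultimately show False
      using not_less_Least[of "nat (k mod int g)" "\<lambda>n. n > 0 \<and> int n \<in> J"] pos g_def by auto
  qed
  then show ?thesis
    using mult[OF g(2)] by (intro exI[of _ "int g"]) (auto simp: dvd_def mult.commute)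
qed

text \<open>The imaginary part sees only the coefficient of \<theta>.\<close>

lemma lattice_coords_unique:
  assumes "Im \<theta> \<noteq> 0" and "of_int i * \<theta> + of_int j = of_int k * \<theta> + of_int l"
  shows "i = k" and "j = l"
proof -
  have "Im (of_int i * \<theta> + of_int j) = Im (of_int k * \<theta> + of_int l)"
    using assms(2) by simp
  then show "i = k" using assms(1) by simp
  then show "j = l" using assms(2) by simp
qed

text \<open>This is the Hermite normal form of a sublattice: \<open>J\<close> collects the
  coefficients of \<theta> and \<open>M\<close> the integers in \<open>L\<close>, and both are
  principal. The second basis vector comes out as an ordinary integer, which later makes congruences
  modulo the level accessible.\<close>

lemma sublattice_basis:
  assumes \<theta>: "Im \<theta> \<noteq> 0" and L: "int_mod.subspace L" and sub: "L \<subseteq> int_mod.span {\<theta>, 1}"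
  shows "\<exists>\<beta> l. L = int_mod.span {\<beta>, of_int l}"
proof -
  define J where "J = {k. \<exists>j. of_int k * \<theta> + of_int j \<in> L}"
  define M where "M = {j. of_int j \<in> L}"
  have "x - y \<in> J" if xy: "x \<in> J" "y \<in> J" for x y
  proof -
    from xy obtain i j where "of_int x * \<theta> + of_int i \<in> L" "of_int y * \<theta> + of_int j \<in> L"
      unfolding J_def by auto
    from int_mod.subspace_diff[OF L this]
    have "of_int (x - y) * \<theta> + of_int (i - j) \<in> L" by (simp add: algebra_simps)
    then show ?thesis unfolding J_def by blast
  qed
  moreover have "0 \<in> J"
    using int_mod.subspace_0[OF L] by (auto simp: J_def intro: exI[of _ 0])
  ultimately obtain g where g: "J = {k. g dvd k}" using int_subgroup_dvd by metis
  have "x - y \<in> M" if "x \<in> M" "y \<in> M" for x y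
    using int_mod.subspace_diff[OF L] that by (force simp: M_def)
  moreover have "0 \<in> M" using int_mod.subspace_0[OF L] by (simp add: M_def)
  ultimately obtain l where l: "M = {k. l dvd k}" using int_subgroup_dvd by metis
  have "g \<in> J" by (simp add: g)
  then obtain j0 where j0: "of_int g * \<theta> + of_int j0 \<in> L" by (auto simp: J_def)
  define \<beta> where "\<beta> = of_int g * \<theta> + of_int j0"
  have "l \<in> M" by (simp add: l)
  then have lL: "of_int l \<in> L" by (simp add: M_def)
  have "x \<in> int_mod.span {\<beta>, of_int l}" if x: "x \<in> L" for x
  proof -
    from x sub obtain k j where kj: "x = of_int k * \<theta> + of_int j"
      using span_pair_iff[of x \<theta> 1] by auto
    with x have "k \<in> J" by (auto simp: J_def)
    then obtain c where c: "k = g * c" by (auto simp: g)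
    have "x - of_int c * \<beta> \<in> L"
      using int_mod.subspace_diff[OF L x int_mod.subspace_scale[OF L j0, of c]] by (simp add: \<beta>_def)
    moreover have "x - of_int c * \<beta> = of_int (j - c * j0)"
      by (simp add: kj c \<beta>_def algebra_simps)
    ultimately have "j - c * j0 \<in> M" by (simp add: M_def)
    then obtain i where "j - c * j0 = l * i" by (auto simp: l)
    then have "x = of_int c * \<beta> + of_int i * of_int l"
      using \<open>x - of_int c * \<beta> = _\<close> by (simp add: algebra_simps)
    then show ?thesis using span_pair_iff by blast
  qed
  moreover have "int_mod.span {\<beta>, of_int l} \<subseteq> L"
    using j0 lL L by (intro int_mod.span_minimal) (auto simp: \<beta>_def)
  ultimately show ?thesis by blast
qed

text \<open>Determinants multiply, and the two matrices have the identity as product, so each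
  determinant is a unit of \<int>.\<close>

lemma int_det_unimodular:
  fixes p q r s p' q' r' s' :: int
  assumes "p * p' + q * r' = 1" "p * q' + q * s' = 0" "r * p' + s * r' = 0" "r * q' + s * s' = 1"
  shows "p * s - q * r = 1 \<or> p * s - q * r = -1"
proof -
  have "(p * s - q * r) * (p' * s' - q' * r')
      = (p * p' + q * r') * (r * q' + s * s') - (p * q' + q * s') * (r * p' + s * r')"
    by (simp add: algebra_simps)
  then have "(p * s - q * r) * (p' * s' - q' * r') = 1" using assms by simp
  then show ?thesis using zmult_eq_1_iff by blast
qed

text \<open>Up to sign, \<open>Im (\<alpha> * cnj \<beta>)\<close> is the area of the period
  parallelogram, so the hypothesis expresses independence of \<alpha>, \<beta> over the reals. Each
  pair is expanded in the other; comparing coordinates with respect to \<alpha>, \<beta> exhibits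
  the inverse matrix.\<close>

lemma lattice_basis_change:
  assumes eq: "int_mod.span {\<alpha>, \<beta>} = int_mod.span {\<alpha>', \<beta>'}" and ind: "Im (\<alpha> * cnj \<beta>) \<noteq> 0"
  shows "\<exists>p q r s. \<alpha> = of_int p * \<alpha>' + of_int q * \<beta>' \<and> \<beta> = of_int r * \<alpha>' + of_int s * \<beta>' \<and>
           (p * s - q * r = 1 \<or> p * s - q * r = -1)"
proof -
  have uniq: "i = 0 \<and> j = 0" if "of_int i * \<alpha> + of_int j * \<beta> = 0" for i j
  proof -
    \<comment> \<open>After multiplication by \<open>cnj \<beta>\<close> the second term is real, so
      the imaginary part isolates \<open>i\<close>.\<close>
    have "of_int i * (\<alpha> * cnj \<beta>) + of_int j * (\<beta> * cnj \<beta>) = 0"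
      using arg_cong[OF that, of "\<lambda>z. z * cnj \<beta>"] by (simp add: algebra_simps)
    then have "Im (of_int i * (\<alpha> * cnj \<beta>) + of_int j * (\<beta> * cnj \<beta>)) = 0" by simp
    then have "i = 0" using ind by (simp add: complex_mult_cnj)
    moreover have "\<beta> \<noteq> 0" using ind by auto
    ultimately show ?thesis using that by simp
  qed
  have "\<alpha> \<in> int_mod.span {\<alpha>', \<beta>'}" "\<beta> \<in> int_mod.span {\<alpha>', \<beta>'}"
    "\<alpha>' \<in> int_mod.span {\<alpha>, \<beta>}" "\<beta>' \<in> int_mod.span {\<alpha>, \<beta>}"
    using eq int_mod.span_base[of _ "{\<alpha>, \<beta>}"] int_mod.span_base[of _ "{\<alpha>', \<beta>'}"] by auto
  then obtain p q r s p' q' r' s' where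
    1: "\<alpha> = of_int p * \<alpha>' + of_int q * \<beta>'" "\<beta> = of_int r * \<alpha>' + of_int s * \<beta>'"
    and 2: "\<alpha>' = of_int p' * \<alpha> + of_int q' * \<beta>" "\<beta>' = of_int r' * \<alpha> + of_int s' * \<beta>"
    unfolding span_pair_iff by metis
  have "of_int (p * p' + q * r' - 1) * \<alpha> + of_int (p * q' + q * s') * \<beta>
      = of_int p * (of_int p' * \<alpha> + of_int q' * \<beta>) + of_int q * (of_int r' * \<alpha> + of_int s' * \<beta>) - \<alpha>"
    by (simp add: algebra_simps)
  also have "\<dots> = 0" by (simp flip: 1 2)
  finally have "p * p' + q * r' - 1 = 0 \<and> p * q' + q * s' = 0" by (rule uniq)
  then have a: "p * p' + q * r' = 1" "p * q' + q * s' = 0" by auto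
  have "of_int (r * p' + s * r') * \<alpha> + of_int (r * q' + s * s' - 1) * \<beta>
      = of_int r * (of_int p' * \<alpha> + of_int q' * \<beta>) + of_int s * (of_int r' * \<alpha> + of_int s' * \<beta>) - \<beta>"
    by (simp add: algebra_simps)
  also have "\<dots> = 0" by (simp flip: 1 2)
  finally have "r * p' + s * r' = 0 \<and> r * q' + s * s' - 1 = 0" by (rule uniq)
  then have b: "r * p' + s * r' = 0" "r * q' + s * s' = 1" by auto
  show ?thesis using 1 int_det_unimodular[OF a b] by blast
qed

text \<open>The adjugate matrix expresses the old basis in the new one.\<close>

lemma span_unimodular:
  assumes det: "p * s - q * r = (1::int)"
  shows "int_mod.span {of_int p * \<alpha> + of_int q * \<beta>, of_int r * \<alpha> + of_int s * \<beta>} = int_mod.span {\<alpha>, \<beta>}"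
proof -
  let ?\<alpha> = "of_int p * \<alpha> + of_int q * \<beta>" and ?\<beta> = "of_int r * \<alpha> + of_int s * \<beta>"
  have "of_int s * ?\<alpha> + of_int (-q) * ?\<beta> = of_int (p * s - q * r) * \<alpha>"
    "of_int (-r) * ?\<alpha> + of_int p * ?\<beta> = of_int (p * s - q * r) * \<beta>"
    by (simp_all add: algebra_simps)
  then have "\<alpha> = of_int s * ?\<alpha> + of_int (-q) * ?\<beta>" "\<beta> = of_int (-r) * ?\<alpha> + of_int p * ?\<beta>"
    unfolding det by simp_all
  then have "\<alpha> \<in> int_mod.span {?\<alpha>, ?\<beta>}" "\<beta> \<in> int_mod.span {?\<alpha>, ?\<beta>}"
    unfolding span_pair_iff by blast+
  moreover have "?\<alpha> \<in> int_mod.span {\<alpha>, \<beta>}" "?\<beta> \<in> int_mod.span {\<alpha>, \<beta>}"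
    by (rule span_pairI)+
  ultimately show ?thesis unfolding int_mod.span_eq by blast
qed

text \<open>Oriented areas scale by the determinant; the sign of a base change is read off from this
  identity.\<close>

lemma Im_basis_change:
  "Im ((of_int p * \<alpha> + of_int q * \<beta>) * cnj (of_int r * \<alpha> + of_int s * \<beta>))
     = of_int (p * s - q * r) * Im (\<alpha> * cnj \<beta>)"
  by (simp add: algebra_simps)

text \<open>The discriminant is a definite description, so independence of the basis has to be
  shown: a base change multiplies the determinant of the conjugates by 1 or -1, which the square
  forgets.\<close>

lemma order_discriminant_eqI:
  assumes R: "R = int_mod.span {\<alpha>, \<beta>}" and ind: "Im (\<alpha> * cnj \<beta>) \<noteq> 0"
    and D: "of_int D = (\<alpha> * cnj \<beta> - cnj \<alpha> * \<beta>)\<^sup>2"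
  shows "order_discriminant R = D"
  unfolding order_discriminant_def
proof (rule the_equality)
  show "\<exists>\<alpha> \<beta>. R = int_mod.span {\<alpha>, \<beta>} \<and> of_int D = (\<alpha> * cnj \<beta> - cnj \<alpha> * \<beta>)\<^sup>2"
    using R D by blast
next
  fix D' assume "\<exists>\<alpha> \<beta>. R = int_mod.span {\<alpha>, \<beta>} \<and> of_int D' = (\<alpha> * cnj \<beta> - cnj \<alpha> * \<beta>)\<^sup>2"
  then obtain \<alpha>' \<beta>' where R': "R = int_mod.span {\<alpha>', \<beta>'}"
    and D': "of_int D' = (\<alpha>' * cnj \<beta>' - cnj \<alpha>' * \<beta>')\<^sup>2" by blast
  from R R' have "int_mod.span {\<alpha>, \<beta>} = int_mod.span {\<alpha>', \<beta>'}" by simp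
  from lattice_basis_change[OF this ind] obtain p q r s :: int where
    1: "\<alpha> = of_int p * \<alpha>' + of_int q * \<beta>'" "\<beta> = of_int r * \<alpha>' + of_int s * \<beta>'"
    and det: "p * s - q * r = 1 \<or> p * s - q * r = -1" by blast
  have *: "\<alpha> * cnj \<beta> - cnj \<alpha> * \<beta> = of_int (p * s - q * r) * (\<alpha>' * cnj \<beta>' - cnj \<alpha>' * \<beta>')"
    unfolding 1 by (simp add: algebra_simps)
  have "(\<alpha> * cnj \<beta> - cnj \<alpha> * \<beta>)\<^sup>2 = (\<alpha>' * cnj \<beta>' - cnj \<alpha>' * \<beta>')\<^sup>2"
    using det unfolding * by (elim disjE) (simp_all only: power_mult_distrib, simp_all)
  then have "of_int D = (of_int D' :: complex)" using D D' by simp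
  then show "D' = D" by simp
qed

section \<open>Products of lattices\<close>

lemma ideal_times_subspace [simp]: "int_mod.subspace (ideal_times A B)"
  by (simp add: ideal_times_def)

lemma ideal_timesI: "x \<in> A \<Longrightarrow> y \<in> B \<Longrightarrow> x * y \<in> ideal_times A B"
  unfolding ideal_times_def by (rule int_mod.span_base) auto

lemma ideal_times_subset_iff:
  assumes "int_mod.subspace C"
  shows "ideal_times A B \<subseteq> C \<longleftrightarrow> (\<forall>x\<in>A. \<forall>y\<in>B. x * y \<in> C)"
proof
  assume "\<forall>x\<in>A. \<forall>y\<in>B. x * y \<in> C"
  then show "ideal_times A B \<subseteq> C"
    unfolding ideal_times_def using assms by (intro int_mod.span_minimal) auto
qed (use ideal_timesI in blast)

lemma subspace_mult_preimage:
  "int_mod.subspace A \<Longrightarrow> int_mod.subspace {z. c * z \<in> A}"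
  by (rule int_subspaceI)
    (auto simp: int_mod.subspace_0 right_diff_distrib intro: int_mod.subspace_diff)

text \<open>The condition on \<open>z\<close> is additive, so testing it on products is enough; this
  replaces an induction over finite sums of products. With \<open>z = 1\<close> it also yields
  membership of \<open>c\<close> itself.\<close>

lemma ideal_times_mult_mem:
  assumes "z \<in> ideal_times A B" "int_mod.subspace C" "\<And>x y. x \<in> A \<Longrightarrow> y \<in> B \<Longrightarrow> c * (x * y) \<in> C"
  shows "c * z \<in> C"
proof -
  have "ideal_times A B \<subseteq> {z. c * z \<in> C}"
    using assms(3) ideal_times_subset_iff[OF subspace_mult_preimage[OF assms(2)]] by blast
  with assms(1) show ?thesis by blast
qed

lemma ideal_times_commute: "ideal_times A B = ideal_times B A"
proof -
  have "ideal_times A B \<subseteq> ideal_times B A" for A B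
    unfolding ideal_times_subset_iff[OF ideal_times_subspace]
    by (subst mult.commute) (blast intro: ideal_timesI)
  then show ?thesis by blast
qed

lemma ideal_times_assoc: "ideal_times (ideal_times A B) C = ideal_times A (ideal_times B C)"
proof
  have "y * z \<in> ideal_times A (ideal_times B C)" if "y \<in> ideal_times A B" "z \<in> C" for y z
  proof -
    have "z * (a * b) \<in> ideal_times A (ideal_times B C)" if "a \<in> A" "b \<in> B" for a b
      using ideal_timesI[OF that(1) ideal_timesI[OF that(2) \<open>z \<in> C\<close>]] by (simp add: ac_simps)
    then have "z * y \<in> ideal_times A (ideal_times B C)"
      by (intro ideal_times_mult_mem[OF \<open>y \<in> ideal_times A B\<close>]) auto
    then show ?thesis by (simp add: mult.commute)
  qed
  then show "ideal_times (ideal_times A B) C \<subseteq> ideal_times A (ideal_times B C)"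
    by (simp add: ideal_times_subset_iff)
  have "x * z \<in> ideal_times (ideal_times A B) C" if "x \<in> A" "z \<in> ideal_times B C" for x z
  proof -
    have "x * (b * c) \<in> ideal_times (ideal_times A B) C" if "b \<in> B" "c \<in> C" for b c
      using ideal_timesI[OF ideal_timesI[OF \<open>x \<in> A\<close> that(1)] that(2)] by (simp add: ac_simps)
    then show ?thesis
      by (intro ideal_times_mult_mem[OF \<open>z \<in> ideal_times B C\<close>]) auto
  qed
  then show "ideal_times A (ideal_times B C) \<subseteq> ideal_times (ideal_times A B) C"
    by (simp add: ideal_times_subset_iff)
qed

lemma mem_principal_ideal: "z \<in> principal_ideal A \<nu> \<longleftrightarrow> (\<exists>x\<in>A. z = \<nu> * x)"
  by (auto simp: principal_ideal_def)

lemma principal_ideal_1 [simp]: "principal_ideal A 1 = A"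
  by (simp add: principal_ideal_def)

lemma principal_ideal_principal_ideal:
  "principal_ideal (principal_ideal A \<mu>) \<nu> = principal_ideal A (\<nu> * \<mu>)"
  unfolding set_eq_iff mem_principal_ideal Bex_def mult.assoc by blast

lemma principal_ideal_subspace:
  "int_mod.subspace A \<Longrightarrow> int_mod.subspace (principal_ideal A \<nu>)"
proof (rule int_subspaceI)
  assume A: "int_mod.subspace A"
  show "0 \<in> principal_ideal A \<nu>"
    using int_mod.subspace_0[OF A] by (auto simp: mem_principal_ideal intro: bexI[of _ 0])
  fix x y assume "x \<in> principal_ideal A \<nu>" "y \<in> principal_ideal A \<nu>"
  then obtain a b where ab: "a \<in> A" "b \<in> A" "x = \<nu> * a" "y = \<nu> * b"
    by (auto simp: mem_principal_ideal)
  then have "a - b \<in> A" "x - y = \<nu> * (a - b)"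
    by (simp_all add: int_mod.subspace_diff[OF A] right_diff_distrib)
  then show "x - y \<in> principal_ideal A \<nu>" unfolding mem_principal_ideal by blast
qed

lemma principal_ideal_closed:
  assumes "\<And>x. x \<in> A \<Longrightarrow> r * x \<in> A" and "z \<in> principal_ideal A \<nu>"
  shows "r * z \<in> principal_ideal A \<nu>"
proof -
  from assms(2) obtain x where "x \<in> A" "z = \<nu> * x" by (auto simp: mem_principal_ideal)
  then have "r * x \<in> A" "r * z = \<nu> * (r * x)" using assms(1) by simp_all
  then show ?thesis unfolding mem_principal_ideal by blast
qed

lemma principal_ideal_span_pair:
  "principal_ideal (int_mod.span {x, y}) \<nu> = int_mod.span {\<nu> * x, \<nu> * y}"
proof -
  have *: "of_int i * (\<nu> * x) + of_int j * (\<nu> * y) = \<nu> * (of_int i * x + of_int j * y)" for i j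
    by (simp add: algebra_simps)
  show ?thesis
    unfolding set_eq_iff mem_principal_ideal Bex_def span_pair_iff * by blast
qed


section \<open>Imaginary quadratic orders\<close>

text \<open>The arithmetic of the field and its order is condensed into a basis \<tau>, 1 with
  \<tau> in the upper half-plane; \<open>T\<close> and \<open>M\<close> turn out to be the trace and
  norm of \<tau>. That every order of an imaginary quadratic field fits this frame is
  \<open>imaginary_quadratic_order\<close>.\<close>

locale quad_order =
  fixes K R :: "complex set" and \<tau> :: complex and T M :: int
  assumes Im_\<tau>: "Im \<tau> > 0"
    and R_eq: "R = int_mod.span {\<tau>, 1}"
    and \<tau>_sq: "\<tau>\<^sup>2 = of_int T * \<tau> - of_int M"
    and K_eq: "K = {x / of_int n | x n. x \<in> R \<and> n > 0}"
begin

lemma R_iff: "x \<in> R \<longleftrightarrow> (\<exists>i j. x = of_int i * \<tau> + of_int j)"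
  by (simp add: R_eq span_pair_iff)

lemma R_subspace [simp]: "int_mod.subspace R"
  by (simp add: R_eq)

lemma R_of_int [simp]: "of_int n \<in> R"
  unfolding R_iff by (rule exI[of _ 0]) auto

lemma R_0 [simp]: "0 \<in> R" and R_1 [simp]: "1 \<in> R" and R_of_nat [simp]: "of_nat k \<in> R"
  using R_of_int[of 0] R_of_int[of 1] R_of_int[of "int k"] by auto

lemma R_add [intro]: "x \<in> R \<Longrightarrow> y \<in> R \<Longrightarrow> x + y \<in> R"
  using int_mod.subspace_add[OF R_subspace] .

lemma R_diff [intro]: "x \<in> R \<Longrightarrow> y \<in> R \<Longrightarrow> x - y \<in> R"
  using int_mod.subspace_diff[OF R_subspace] .

lemma R_mult [intro]: "x \<in> R \<Longrightarrow> y \<in> R \<Longrightarrow> x * y \<in> R"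
proof -
  assume "x \<in> R" "y \<in> R"
  then obtain i j k l where "x = of_int i * \<tau> + of_int j" "y = of_int k * \<tau> + of_int l"
    unfolding R_iff by auto
  then have "x * y = of_int (i * k) * \<tau>\<^sup>2 + of_int (i * l + j * k) * \<tau> + of_int (j * l)"
    by (simp add: algebra_simps power2_eq_square)
  also have "\<dots> = of_int (i * k * T + i * l + j * k) * \<tau> + of_int (j * l - i * k * M)"
    by (simp add: \<tau>_sq ring_distribs)
  finally show ?thesis unfolding R_iff by blast
qed

text \<open>Subtracting the conjugate equation leaves a multiple of
  \<open>\<tau> - cnj \<tau>\<close>, which is nonzero off the real axis.\<close>

lemma \<tau>_trace: "\<tau> + cnj \<tau> = of_int T"
proof -
  have "(cnj \<tau>)\<^sup>2 = of_int T * cnj \<tau> - of_int M"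
    using arg_cong[OF \<tau>_sq, of cnj] by simp
  then have "\<tau>\<^sup>2 - (cnj \<tau>)\<^sup>2 = of_int T * (\<tau> - cnj \<tau>)"
    by (simp add: \<tau>_sq right_diff_distrib)
  then have "(\<tau> - cnj \<tau>) * (\<tau> + cnj \<tau> - of_int T) = 0"
    by (simp add: algebra_simps power2_eq_square)
  moreover have "\<tau> \<noteq> cnj \<tau>" using Im_\<tau> by (auto simp: complex_eq_iff)
  ultimately show ?thesis by simp
qed

lemma \<tau>_norm: "\<tau> * cnj \<tau> = of_int M"
proof -
  have "\<tau> * cnj \<tau> = (\<tau> + cnj \<tau>) * \<tau> - \<tau>\<^sup>2" by (simp add: algebra_simps power2_eq_square)
  then have "\<tau> * cnj \<tau> = of_int T * \<tau> - \<tau>\<^sup>2" unfolding \<tau>_trace .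
  then show ?thesis by (simp add: \<tau>_sq)
qed

lemma R_cnj [intro]: assumes "x \<in> R" shows "cnj x \<in> R"
proof -
  obtain i j where x: "x = of_int i * \<tau> + of_int j" using assms R_iff by auto
  have "cnj x = of_int (- i) * \<tau> + of_int i * (\<tau> + cnj \<tau>) + of_int j"
    unfolding x by (simp add: algebra_simps)
  also have "\<dots> = of_int (- i) * \<tau> + of_int (i * T + j)"
    unfolding \<tau>_trace by simp
  finally have "cnj x = of_int (- i) * \<tau> + of_int (i * T + j)" .
  then show ?thesis unfolding R_iff by blast
qed

lemma R_trace: assumes "x \<in> R" obtains t where "x + cnj x = of_int t"
proof -
  obtain i j where "x = of_int i * \<tau> + of_int j" using assms R_iff by auto
  then have "x + cnj x = of_int i * (\<tau> + cnj \<tau>) + of_int (2 * j)" by (simp add: algebra_simps)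
  also have "\<dots> = of_int (i * T + 2 * j)" by (simp add: \<tau>_trace)
  finally show ?thesis using that by blast
qed

text \<open>The norm form i^2 M + i j T + j^2 has integral values; its sign is that of the square of
  \<open>cmod x\<close>.\<close>

lemma R_norm: assumes "x \<in> R" obtains n where "x * cnj x = of_int n" "n \<ge> 0" "n = 0 \<longleftrightarrow> x = 0"
proof -
  obtain i j where "x = of_int i * \<tau> + of_int j" using assms R_iff by auto
  then have "x * cnj x = of_int (i\<^sup>2) * (\<tau> * cnj \<tau>) + of_int (i * j) * (\<tau> + cnj \<tau>) + of_int (j\<^sup>2)"
    by (simp add: algebra_simps power2_eq_square)
  also have "\<dots> = of_int (i\<^sup>2 * M + i * j * T + j\<^sup>2)" by (simp add: \<tau>_trace \<tau>_norm)
  finally obtain n where n: "x * cnj x = of_int n" by blast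
  moreover from n have "of_int n = (cmod x)\<^sup>2"
    by (metis complex_norm_square of_real_eq_iff of_real_of_int_eq)
  then have "real_of_int n \<ge> 0" by simp
  then have "n \<ge> 0" by simp
  moreover have "n = 0 \<longleftrightarrow> x = 0" using n by (metis complex_cnj_zero_iff mult_eq_0_iff of_int_eq_0_iff)
  ultimately show ?thesis using that by blast
qed

lemma \<tau>_in_R: "\<tau> \<in> R"
  unfolding R_iff by (intro exI[of _ 1] exI[of _ 0]) auto

lemma R_real_imp_int:
  assumes "x \<in> R" "Im x = 0" obtains n where "x = of_int n"
proof -
  obtain i j where x: "x = of_int i * \<tau> + of_int j" using assms R_iff by auto
  then have "i = 0" using assms(2) Im_\<tau> by simp
  with x that show ?thesis by simp
qed

section \<open>The field as quotients of the order by positive integers\<close>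

lemma K_divide_int: "x \<in> R \<Longrightarrow> n > 0 \<Longrightarrow> x / of_int n \<in> K"
  by (auto simp: K_eq)

lemma R_subset_K: "R \<subseteq> K"
  using K_divide_int[of _ 1] by auto

lemma K_mult [intro]: "x \<in> K \<Longrightarrow> y \<in> K \<Longrightarrow> x * y \<in> K"
proof -
  assume "x \<in> K" "y \<in> K"
  then obtain x' m y' n where "x' \<in> R" "m > 0" "x = x' / of_int m" "y' \<in> R" "n > 0" "y = y' / of_int n"
    unfolding K_eq by auto
  then show ?thesis using K_divide_int[of "x' * y'" "m * n"] by (simp add: R_mult)
qed

text \<open>Multiplying by the conjugate turns the denominator into a norm, which is a positive
  integer.\<close>

lemma K_inverse [intro]: assumes "x \<in> K" shows "inverse x \<in> K"
proof (cases "x = 0")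
  case True
  then show ?thesis using assms by simp
next
  case False
  obtain x' m where x: "x' \<in> R" "m > 0" "x = x' / of_int m" using assms unfolding K_eq by auto
  obtain n where n: "x' * cnj x' = of_int n" "n \<ge> 0" "n = 0 \<longleftrightarrow> x' = 0" using R_norm[OF x(1)] .
  have "x' \<noteq> 0" using x False by auto
  have "n > 0" using n \<open>x' \<noteq> 0\<close> by linarith
  have "inverse x = (of_int m * cnj x') / (x' * cnj x')" using x(3) \<open>x' \<noteq> 0\<close> by (simp add: field_simps)
  also have "\<dots> = (of_int m * cnj x') / of_int n" by (simp add: n)
  also have "\<dots> \<in> K" using x \<open>n > 0\<close> by (intro K_divide_int R_mult R_cnj) auto
  finally show ?thesis .
qed

lemma K_divide [intro]: "x \<in> K \<Longrightarrow> y \<in> K \<Longrightarrow> x / y \<in> K"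
  by (simp add: divide_inverse K_mult K_inverse)

lemma K_denominator: assumes "x \<in> K" obtains n where "n > 0" "of_int n * x \<in> R"
  using assms unfolding K_eq by auto

section \<open>Fractional ideals and their products\<close>

lemma fractional_idealI:
  assumes "int_mod.subspace A" "A \<noteq> {0}" "\<And>r x. r \<in> R \<Longrightarrow> x \<in> A \<Longrightarrow> r * x \<in> A"
    and "d \<in> R" "d \<noteq> 0" "\<And>x. x \<in> A \<Longrightarrow> d * x \<in> R"
  shows "fractional_ideal K R A"
proof -
  have "x \<in> K" if "x \<in> A" for x
  proof -
    \<comment> \<open>Containment in the field is automatic: \<open>d * x\<close> and
      \<open>d\<close> both lie in the order.\<close>
    have "(d * x) / d \<in> K" using assms(4,6) that R_subset_K by (intro K_divide) auto
    then show ?thesis using assms(5) by simp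
  qed
  with assms show ?thesis unfolding fractional_ideal_def by blast
qed

lemma fractional_ideal_denominator:
  assumes "fractional_ideal K R A"
  obtains d where "d \<in> R" "d \<noteq> 0" "\<And>x. x \<in> A \<Longrightarrow> d * x \<in> R"
proof -
  have "\<exists>d\<in>R - {0}. \<forall>x\<in>A. d * x \<in> R" using assms by (simp add: fractional_ideal_def)
  then show ?thesis using that by blast
qed

lemma fractional_ideal_nonzero:
  assumes "fractional_ideal K R A"
  obtains a where "a \<in> A" "a \<noteq> 0"
proof -
  have "A \<noteq> {0}" "0 \<in> A"
    using assms by (simp_all add: fractional_ideal_def int_mod.subspace_0)
  then show ?thesis using that by blast
qed

lemma ideal_times_R:
  assumes "int_mod.subspace A" "\<And>r x. r \<in> R \<Longrightarrow> x \<in> A \<Longrightarrow> r * x \<in> A"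
  shows "ideal_times R A = A"
proof
  show "ideal_times R A \<subseteq> A" using assms by (simp add: ideal_times_subset_iff)
  show "A \<subseteq> ideal_times R A" using ideal_timesI[of 1 R _ A] by auto
qed

text \<open>Multiplying by a principal ideal scales the lattice, so equations between ideal classes
  become homotheties.\<close>

lemma ideal_times_principal:
  assumes "int_mod.subspace A" "\<And>r x. r \<in> R \<Longrightarrow> x \<in> A \<Longrightarrow> r * x \<in> A"
  shows "ideal_times (principal_ideal R \<nu>) A = principal_ideal A \<nu>"
proof
  show "ideal_times (principal_ideal R \<nu>) A \<subseteq> principal_ideal A \<nu>"
  proof -
    have "\<nu> * x * y \<in> principal_ideal A \<nu>" if "x \<in> R" "y \<in> A" for x y
      using assms(2)[OF that] by (auto simp: mem_principal_ideal mult.assoc)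
    then show ?thesis
      by (subst ideal_times_subset_iff) (auto simp: principal_ideal_subspace assms(1) mem_principal_ideal)
  qed
  show "principal_ideal A \<nu> \<subseteq> ideal_times (principal_ideal R \<nu>) A"
  proof
    fix z assume "z \<in> principal_ideal A \<nu>"
    then obtain x where x: "x \<in> A" "z = \<nu> * x" by (auto simp: mem_principal_ideal)
    have "\<nu> * 1 \<in> principal_ideal R \<nu>" unfolding mem_principal_ideal using R_1 by blast
    from ideal_timesI[OF this x(1)] show "z \<in> ideal_times (principal_ideal R \<nu>) A"
      by (simp add: x(2))
  qed
qed

lemma principal_times_principal:
  "ideal_times (principal_ideal R \<mu>) (principal_ideal R \<nu>) = principal_ideal R (\<mu> * \<nu>)"
proof -
  have "int_mod.subspace (principal_ideal R \<nu>)" by (simp add: principal_ideal_subspace)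
  then have "ideal_times (principal_ideal R \<mu>) (principal_ideal R \<nu>)
      = principal_ideal (principal_ideal R \<nu>) \<mu>"
    by (rule ideal_times_principal) (rule principal_ideal_closed[OF R_mult])
  then show ?thesis by (simp add: principal_ideal_principal_ideal)
qed

lemma fractional_ideal_principal:
  assumes "x \<in> K" "x \<noteq> 0"
  shows "fractional_ideal K R (principal_ideal R x)"
proof -
  obtain n where n: "n > 0" "of_int n * x \<in> R" using K_denominator[OF assms(1)] .
  show ?thesis
  proof (rule fractional_idealI[of _ "of_int n"])
    have "x * 1 \<in> principal_ideal R x" unfolding mem_principal_ideal using R_1 by blast
    then show "principal_ideal R x \<noteq> {0}" using assms(2) by auto
    show "of_int n * y \<in> R" if "y \<in> principal_ideal R x" for y
      using that n R_mult by (auto simp: mem_principal_ideal simp flip: mult.assoc)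
    show "r * y \<in> principal_ideal R x" if "r \<in> R" "y \<in> principal_ideal R x" for r y
      by (rule principal_ideal_closed[OF R_mult that(2)]) (rule that(1))
  qed (use n in \<open>simp_all add: principal_ideal_subspace\<close>)
qed

lemma fractional_ideal_times:
  assumes A: "fractional_ideal K R A" and B: "fractional_ideal K R B"
  shows "fractional_ideal K R (ideal_times A B)"
proof -
  obtain d e where d: "d \<in> R" "d \<noteq> 0" "\<And>x. x \<in> A \<Longrightarrow> d * x \<in> R"
    and e: "e \<in> R" "e \<noteq> 0" "\<And>x. x \<in> B \<Longrightarrow> e * x \<in> R"
    using fractional_ideal_denominator[OF A] fractional_ideal_denominator[OF B] by metis
  obtain a b where ab: "a \<in> A" "a \<noteq> 0" "b \<in> B" "b \<noteq> 0"
    using fractional_ideal_nonzero[OF A] fractional_ideal_nonzero[OF B] by metis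
  show ?thesis
  proof (rule fractional_idealI[of _ "d * e"])
    have "a * b \<in> ideal_times A B" "a * b \<noteq> 0" using ideal_timesI ab by simp_all
    then show "ideal_times A B \<noteq> {0}" by blast
    show "r * z \<in> ideal_times A B" if "r \<in> R" "z \<in> ideal_times A B" for r z
    proof (rule ideal_times_mult_mem[OF that(2)])
      fix x y assume "x \<in> A" "y \<in> B"
      moreover from this have "r * x \<in> A" using A that(1) by (simp add: fractional_ideal_def)
      ultimately show "r * (x * y) \<in> ideal_times A B"
        using ideal_timesI[of "r * x" A y B] by (simp add: mult.assoc)
    qed simp
    show "d * e * z \<in> R" if "z \<in> ideal_times A B" for z
    proof (rule ideal_times_mult_mem[OF that])
      fix x y assume "x \<in> A" "y \<in> B"
      then have "(d * x) * (e * y) \<in> R" using d e by blast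
      then show "d * e * (x * y) \<in> R" by (simp add: ac_simps)
    qed simp
  qed (use d e in auto)
qed

section \<open>Invertible ideals and their group\<close>

abbreviation proper :: "complex set \<Rightarrow> bool" where
  "proper \<equiv> proper_fractional_ideal K R"

lemma properD:
  assumes "proper A"
  shows "fractional_ideal K R A" "int_mod.subspace A" "\<And>r x. r \<in> R \<Longrightarrow> x \<in> A \<Longrightarrow> r * x \<in> A" "A \<noteq> {0}"
  using assms by (auto simp: proper_fractional_ideal_def fractional_ideal_def)

lemma proper_inverse:
  assumes "proper A" obtains B where "proper B" "ideal_times A B = R" "ideal_times B A = R"
proof -
  from assms obtain B where B: "fractional_ideal K R B" "ideal_times A B = R"
    unfolding proper_fractional_ideal_def by blast
  moreover have "ideal_times B A = R" using B(2) ideal_times_commute by simp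
  ultimately show ?thesis
    using assms that unfolding proper_fractional_ideal_def by blast
qed

lemma proper_times:
  assumes A: "proper A" and B: "proper B"
  shows "proper (ideal_times A B)"
proof -
  obtain A' B' where A': "proper A'" "ideal_times A A' = R" and B': "proper B'" "ideal_times B B' = R"
    using proper_inverse[OF A] proper_inverse[OF B] by metis
  have "ideal_times (ideal_times A B) (ideal_times A' B')
      = ideal_times (ideal_times A A') (ideal_times B B')"
    by (metis ideal_times_assoc ideal_times_commute)
  also have "\<dots> = R" using A' B' by (simp add: ideal_times_R R_mult)
  finally have "ideal_times (ideal_times A B) (ideal_times A' B') = R" .
  moreover have "fractional_ideal K R (ideal_times A B)" "fractional_ideal K R (ideal_times A' B')"
    using A B A' B' by (simp_all add: fractional_ideal_times properD(1))
  ultimately show ?thesis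
    unfolding proper_fractional_ideal_def by blast
qed

lemma proper_principal:
  assumes "x \<in> K" "x \<noteq> 0"
  shows "proper (principal_ideal R x)"
proof -
  have "ideal_times (principal_ideal R x) (principal_ideal R (inverse x)) = R"
    using assms(2) by (simp add: principal_times_principal)
  then show ?thesis
    using assms fractional_ideal_principal K_inverse unfolding proper_fractional_ideal_def
    by (metis nonzero_imp_inverse_nonzero)
qed

lemma comm_group_ideal_group: "comm_group (ideal_group K R)"
proof (rule comm_groupI)
  show "\<one>\<^bsub>ideal_group K R\<^esub> \<in> carrier (ideal_group K R)"
    using proper_principal[of 1] subsetD[OF R_subset_K R_1] by (simp add: ideal_group_def)
qed (auto simp: ideal_group_def proper_times ideal_times_assoc ideal_times_R properD
    intro: ideal_times_commute[THEN equalityD1, THEN subsetD] elim: proper_inverse)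

text \<open>If B is the inverse of \<open>A\<close>, then x = x 1 lies in x A B, hence in A B, which
  is the order. An invertible ideal thus has no multipliers beyond the order.\<close>

lemma multiplier_in_R:
  assumes A: "proper A" and x: "\<And>a. a \<in> A \<Longrightarrow> x * a \<in> A"
  shows "x \<in> R"
proof -
  obtain B where B: "ideal_times A B = R" using proper_inverse[OF A] by metis
  have "x * 1 \<in> R"
    by (rule ideal_times_mult_mem[of _ A B])
      (use x B in \<open>auto simp flip: mult.assoc intro: ideal_timesI\<close>)
  then show ?thesis by simp
qed

end

section \<open>Roots and lattices of quadratic forms\<close>

lemma pos_inverse_mod:
  assumes "coprime a (int N)" "N > 0"
  obtains u where "u > 0" "[a * u = 1] (mod int N)"
proof -
  obtain v where v: "[a * v = 1] (mod int N)" using cong_solve_coprime_int[OF assms(1)] by auto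
  \<comment> \<open>The shift by \<open>N\<close> guarantees positivity even if the residue is 0, as
    happens for \<open>N = 1\<close>.\<close>
  have "[a * (v mod int N + int N) = a * v] (mod int N)"
    by (intro cong_mult cong_refl) (simp add: cong_def)
  then have "[a * (v mod int N + int N) = 1] (mod int N)" using v by (rule cong_trans)
  moreover have "v mod int N + int N > 0"
    using assms(2) by (simp add: add_nonneg_pos)
  ultimately show ?thesis using that by blast
qed

declare form_root.simps [simp del]

context quad_order
begin

definition D :: int where "D = T\<^sup>2 - 4 * M"

lemma \<tau>_diff_sq: "(\<tau> - cnj \<tau>)\<^sup>2 = of_int D"
proof -
  have "(\<tau> - cnj \<tau>)\<^sup>2 = (\<tau> + cnj \<tau>)\<^sup>2 - 4 * (\<tau> * cnj \<tau>)"
    by (simp add: power2_eq_square algebra_simps)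
  then show ?thesis by (simp add: \<tau>_trace \<tau>_norm D_def)
qed

lemma order_discriminant_R: "order_discriminant R = D"
  by (rule order_discriminant_eqI[OF R_eq]) (use Im_\<tau> in \<open>simp_all add: \<tau>_diff_sq\<close>)

lemma csqrt_D: "csqrt (of_int D) = \<tau> - cnj \<tau>"
  by (rule csqrt_unique[OF \<tau>_diff_sq]) (use Im_\<tau> in simp)

lemma D_neg: "D < 0"
proof -
  have "complex_of_int D = of_real (- (4 * (Im \<tau>)\<^sup>2))"
    unfolding \<tau>_diff_sq[symmetric] by (simp add: complex_eq_iff power2_eq_square)
  then have "real_of_int D = - (4 * (Im \<tau>)\<^sup>2)"
    by (metis of_real_eq_iff of_real_of_int_eq)
  then have "real_of_int D < 0" using Im_\<tau> by simp
  then show ?thesis by simp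
qed

text \<open>Equal discriminants force \<open>b\<close> and \<open>T\<close> to have the same parity,
  so a \<omega> is a translate of \<tau> by an integer. Hence a \<omega> and 1 again form a basis of
  the order.\<close>

lemma form_root_scaled:
  assumes "(a, b, c) \<in> forms D N"
  obtains k where "of_int a * form_root D (a, b, c) = \<tau> - of_int k" "T + b = 2 * k"
proof -
  have ab: "b\<^sup>2 - 4 * a * c = T\<^sup>2 - 4 * M" "a > 0" using assms by (auto simp: forms_def D_def)
  then have "T\<^sup>2 - b\<^sup>2 = 2 * (2 * (M - a * c))" by simp
  then have "even (T\<^sup>2 - b\<^sup>2)" by (metis dvd_triv_left)
  then have "even (T + b)" by simp
  then obtain k where k: "T + b = 2 * k" by blast
  have "of_int a * form_root D (a, b, c) = (- of_int b + (\<tau> - cnj \<tau>)) / 2"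
    using ab(2) by (simp add: csqrt_D form_root.simps)
  also have "\<dots> = (2 * \<tau> - (of_int b + (\<tau> + cnj \<tau>))) / 2" by simp
  also have "\<dots> = \<tau> - of_int (T + b) / 2" unfolding \<tau>_trace by (simp add: field_simps)
  also have "\<dots> = \<tau> - of_int k" by (simp add: k)
  finally show ?thesis using that k by blast
qed

lemma Im_form_root: assumes "(a, b, c) \<in> forms D N" shows "Im (form_root D (a, b, c)) > 0"
proof -
  obtain k where "of_int a * form_root D (a, b, c) = \<tau> - of_int k"
    using form_root_scaled[OF assms] by blast
  then have "Im (of_int a * form_root D (a, b, c)) = Im (\<tau> - of_int k)" by (rule arg_cong)
  then have "of_int a * Im (form_root D (a, b, c)) > 0" using Im_\<tau> by simp
  moreover have "a > 0" using assms by (simp add: forms_def)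
  ultimately show ?thesis by (simp add: zero_less_mult_iff)
qed

text \<open>The root has trace - b / a and norm c / a; clearing the denominator gives relations
  between integral elements.\<close>

lemma form_root_conj:
  assumes "(a, b, c) \<in> forms D N" and \<omega>: "\<omega> = form_root D (a, b, c)"
  shows "of_int a * cnj \<omega> = - of_int b - of_int a * \<omega>" "\<omega> * (of_int a * cnj \<omega>) = of_int c"
    "of_int a * \<omega>\<^sup>2 + of_int b * \<omega> + of_int c = 0"
proof -
  obtain k where k: "of_int a * \<omega> = \<tau> - of_int k" "T + b = 2 * k"
    using form_root_scaled[OF assms(1)] \<omega> by blast
  have ac: "b\<^sup>2 - 4 * a * c = T\<^sup>2 - 4 * M" "a > 0" using assms(1) by (auto simp: forms_def D_def)
  have "of_int a * cnj \<omega> = cnj \<tau> - of_int k" using arg_cong[OF k(1), of cnj] by simp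
  then have "of_int a * cnj \<omega> + of_int a * \<omega> = (\<tau> + cnj \<tau>) - of_int (2 * k)" by (simp add: k(1))
  also have "\<dots> = - of_int b" unfolding \<tau>_trace k(2)[symmetric] by simp
  finally show 1: "of_int a * cnj \<omega> = - of_int b - of_int a * \<omega>" by (simp add: algebra_simps)
  have "of_int a * (\<omega> * (of_int a * cnj \<omega>)) = (\<tau> - of_int k) * (cnj \<tau> - of_int k)"
    using k(1) \<open>of_int a * cnj \<omega> = cnj \<tau> - of_int k\<close> by (metis mult.assoc)
  also have "\<dots> = \<tau> * cnj \<tau> - of_int k * (\<tau> + cnj \<tau>) + of_int (k * k)" by (simp add: algebra_simps)
  also have "\<dots> = of_int (M - k * T + k * k)" by (simp add: \<tau>_trace \<tau>_norm)
  also have "M - k * T + k * k = a * c"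
  proof -
    have "b = 2 * k - T" using k(2) by simp
    then have "(2 * k - T)\<^sup>2 - 4 * a * c = T\<^sup>2 - 4 * M" using ac(1) by simp
    then have "4 * (M - k * T + k * k) = 4 * (a * c)" by (simp add: power2_eq_square algebra_simps)
    then show ?thesis by simp
  qed
  finally show 2: "\<omega> * (of_int a * cnj \<omega>) = of_int c" using ac(2) by simp
  show "of_int a * \<omega>\<^sup>2 + of_int b * \<omega> + of_int c = 0"
  proof -
    have "of_int a * \<omega>\<^sup>2 + of_int b * \<omega> + of_int c
        = of_int c - \<omega> * (- of_int b - of_int a * \<omega>)" by Groebner_Basis.algebra
    then show ?thesis using 2 unfolding 1 by simp
  qed
qed

text \<open>Completing the square leaves two values for 2 a z + b, the square roots of the
  discriminant; positivity of \<open>Im z\<close> selects one.\<close>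

lemma form_root_unique:
  assumes "b\<^sup>2 - 4 * a * c = D" "a > 0" and z: "Im z > 0" "of_int a * z\<^sup>2 + of_int b * z + of_int c = 0"
  shows "form_root D (a, b, c) = z"
proof -
  have "(2 * of_int a * z + of_int b)\<^sup>2
      = 4 * of_int a * (of_int a * z\<^sup>2 + of_int b * z + of_int c) + of_int (b\<^sup>2 - 4 * a * c)"
    unfolding of_int_diff of_int_mult of_int_power of_int_numeral by Groebner_Basis.algebra
  then have "(2 * of_int a * z + of_int b)\<^sup>2 = (\<tau> - cnj \<tau>)\<^sup>2"
    using z(2) assms(1) by (simp add: \<tau>_diff_sq)
  moreover have "2 * of_int a * z + of_int b \<noteq> - (\<tau> - cnj \<tau>)"
  proof
    assume "2 * of_int a * z + of_int b = - (\<tau> - cnj \<tau>)"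
    then have "Im (2 * of_int a * z + of_int b) = Im (- (\<tau> - cnj \<tau>))" by (rule arg_cong)
    then have "of_int a * Im z = - Im \<tau>" by (simp add: mult.commute)
    moreover have "of_int a * Im z > 0" using assms(2) z(1) by simp
    ultimately show False using Im_\<tau> by linarith
  qed
  ultimately have "2 * of_int a * z + of_int b = \<tau> - cnj \<tau>"
    unfolding power2_eq_iff by blast
  then show ?thesis using assms(2) by (simp add: csqrt_D form_root.simps field_simps)
qed

lemma R_form_basis:
  assumes "(a, b, c) \<in> forms D N"
  shows "R = int_mod.span {of_int a * form_root D (a, b, c), 1}"
proof -
  obtain k where k: "of_int a * form_root D (a, b, c) = \<tau> - of_int k"
    using form_root_scaled[OF assms] by blast
  show ?thesis
    unfolding k R_eq using span_unimodular[of 1 1 "-k" 0 \<tau> 1] by simp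
qed

text \<open>Stability under the whole order reduces to the action of the generator \<theta> on the
  two basis vectors.\<close>

lemma span_pair_closed:
  assumes R: "R = int_mod.span {\<theta>, 1}"
    and "\<theta> * x \<in> int_mod.span {x, y}" "\<theta> * y \<in> int_mod.span {x, y}"
    and r: "r \<in> R" and z: "z \<in> int_mod.span {x, y}"
  shows "r * z \<in> int_mod.span {x, y}"
proof -
  obtain i j where z: "z = of_int i * x + of_int j * y" using z span_pair_iff by auto
  obtain k l where r: "r = of_int k * \<theta> + of_int l" using r R span_pair_iff[of r \<theta> 1] by auto
  have "r * z = of_int k * (of_int i * (\<theta> * x) + of_int j * (\<theta> * y)) + of_int l * z"
    by (simp add: z r algebra_simps)
  then show ?thesis
    using assms(2-3) \<open>z \<in> int_mod.span {x, y}\<close>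
    by (metis int_mod.span_add int_mod.span_scale)
qed

text \<open>The inverse of [\<omega>, 1] is the conjugate lattice scaled by \<open>a\<close>. The
  product of the two contains a, c, a \<omega> and \<open>a * cnj \<omega>\<close>, and the negated
  sum of the last two is b; as the form is primitive, Bezout yields 1.\<close>

lemma form_lattice_proper:
  assumes Q: "(a, b, c) \<in> forms D N"
  shows "proper (form_lattice D (a, b, c))"
proof -
  define \<omega> where "\<omega> = form_root D (a, b, c)"
  define A where "A = int_mod.span {\<omega>, 1}"
  define B where "B = int_mod.span {of_int a * cnj \<omega>, of_int a}"
  note * = form_root_conj[OF Q \<omega>_def]
  have a: "a > 0" and g: "gcd a (gcd b c) = 1" using Q by (auto simp: forms_def)
  have R: "R = int_mod.span {of_int a * \<omega>, 1}" using R_form_basis[OF Q] by (simp add: \<omega>_def)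
  have a\<omega>: "of_int a * \<omega> \<in> R" unfolding R by (rule int_mod.span_base) simp
  have a\<omega>': "of_int a * cnj \<omega> \<in> R" unfolding *(1) using a\<omega> R_of_int[of "- b"] by (auto intro: R_diff)
  have "fractional_ideal K R A"
  proof (rule fractional_idealI[of _ "of_int a"])
    show "A \<noteq> {0}" using int_mod.span_base[of 1 "{\<omega>, 1}"] by (auto simp: A_def)
    have "of_int a * \<omega> * \<omega> = of_int (- b) * \<omega> + of_int (- c) * 1"
      using *(3) by (simp add: power2_eq_square algebra_simps add_eq_0_iff)
    then have "of_int a * \<omega> * \<omega> \<in> A" unfolding A_def by (metis span_pairI)
    moreover have "of_int a * \<omega> * 1 \<in> A"
      using span_pairI[of a \<omega> 0 1] by (simp add: A_def)
    ultimately show "r * x \<in> A" if "r \<in> R" "x \<in> A" for r x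
      using span_pair_closed[OF R _ _ that(1)] that(2) unfolding A_def by blast
    show "of_int a * x \<in> R" if x: "x \<in> A" for x
    proof -
      obtain i j where "x = of_int i * \<omega> + of_int j" using x span_pair_iff[of x \<omega> 1] by (auto simp: A_def)
      then have "of_int a * x = of_int i * (of_int a * \<omega>) + of_int a * of_int j" by (simp add: algebra_simps)
      also have "\<dots> \<in> R" by (intro R_add R_mult R_of_int a\<omega>)
      finally show ?thesis .
    qed
  qed (use a in \<open>auto simp: A_def\<close>)
  moreover have "fractional_ideal K R B"
  proof (rule fractional_idealI[of _ 1])
    show "B \<noteq> {0}"
      using int_mod.span_base[of "of_int a" "{of_int a * cnj \<omega>, of_int a}"] a by (auto simp: B_def)
    have "of_int a * \<omega> * (of_int a * cnj \<omega>) = of_int 0 * (of_int a * cnj \<omega>) + of_int c * of_int a"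
      using *(2) by simp
    then have "of_int a * \<omega> * (of_int a * cnj \<omega>) \<in> B" unfolding B_def by (metis span_pairI)
    moreover have "of_int a * \<omega> * of_int a = of_int (- a) * (of_int a * cnj \<omega>) + of_int (- b) * of_int a"
      unfolding *(1) by (simp add: algebra_simps)
    then have "of_int a * \<omega> * of_int a \<in> B" unfolding B_def by (metis span_pairI)
    ultimately show "r * x \<in> B" if "r \<in> R" "x \<in> B" for r x
      using span_pair_closed[OF R _ _ that(1)] that(2) unfolding B_def by blast
    have "B \<subseteq> R" unfolding B_def by (rule int_mod.span_minimal) (use a\<omega>' in auto)
    then show "1 * x \<in> R" if "x \<in> B" for x using that by auto
  qed (auto simp: B_def)
  moreover have "ideal_times A B = R"
  proof
    have "x * y \<in> R" if x: "x \<in> A" and y: "y \<in> B" for x y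
    proof -
      obtain i j where ij: "x = of_int i * \<omega> + of_int j"
        using x span_pair_iff[of x \<omega> 1] by (auto simp: A_def)
      obtain k l where kl: "y = of_int k * (of_int a * cnj \<omega>) + of_int l * of_int a"
        using y span_pair_iff by (auto simp: B_def)
      have "x * y = of_int (i * k) * (\<omega> * (of_int a * cnj \<omega>)) + of_int (i * l) * (of_int a * \<omega>)
          + of_int (j * k) * (of_int a * cnj \<omega>) + of_int (j * l * a)"
        unfolding ij kl of_int_mult by Groebner_Basis.algebra
      also have "\<dots> \<in> R" unfolding *(2) by (intro R_add R_mult R_of_int a\<omega> a\<omega>')
      finally show ?thesis .
    qed
    then show "ideal_times A B \<subseteq> R" by (simp add: ideal_times_subset_iff)
    have A: "\<omega> \<in> A" "1 \<in> A" and B: "of_int a * cnj \<omega> \<in> B" "of_int a \<in> B"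
      by (auto simp: A_def B_def intro: int_mod.span_base)
    have 1: "of_int c \<in> ideal_times A B" "of_int a \<in> ideal_times A B" "of_int a * \<omega> \<in> ideal_times A B"
      "of_int a * cnj \<omega> \<in> ideal_times A B"
      using ideal_timesI[OF A(1) B(1)] ideal_timesI[OF A(2) B(2)] ideal_timesI[OF A(1) B(2)]
        ideal_timesI[OF A(2) B(1)] *(2) by (simp_all add: mult.commute)
    have "- (of_int a * cnj \<omega> + of_int a * \<omega>) \<in> ideal_times A B"
      using 1 by (intro int_mod.subspace_neg int_mod.subspace_add) auto
    then have 2: "of_int b \<in> ideal_times A B" unfolding *(1) by simp
    obtain u v where uv: "u * b + v * c = gcd b c" using bezout_int by blast
    obtain s t where "s * a + t * gcd b c = 1" using bezout_int[of a "gcd b c"] g by auto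
    then have "s * a + t * (u * b + v * c) = 1" by (simp add: uv)
    then have "of_int 1 = (of_int s * of_int a + of_int t * (of_int u * of_int b + of_int v * of_int c) :: complex)"
      by (metis of_int_add of_int_mult)
    also have "\<dots> \<in> ideal_times A B"
      using 1 2 by (intro int_mod.subspace_add int_mod.subspace_scale) auto
    finally show "R \<subseteq> ideal_times A B"
      unfolding R using 1(3) by (intro int_mod.span_minimal) auto
  qed
  ultimately show ?thesis
    unfolding proper_fractional_ideal_def form_lattice_def A_def \<omega>_def by blast
qed

text \<open>Eliminating the square of \<open>z\<close> leaves a linear relation over \<int>, which
  must vanish since \<open>z\<close> is not real. The forms are therefore proportional, and equal
  nonzero discriminants with positive leading coefficients make the ratio 1.\<close>

lemma form_ext:
  assumes "b\<^sup>2 - 4 * a * c = D" "b'\<^sup>2 - 4 * a' * c' = D" "a > 0" "a' > 0" "Im z > 0"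
    and z: "of_int a * z\<^sup>2 + of_int b * z + of_int c = 0" "of_int a' * z\<^sup>2 + of_int b' * z + of_int c' = 0"
  shows "(a, b, c) = (a', b', c')"
proof -
  have "of_int (a' * b - a * b') * z + of_int (a' * c - a * c')
      = of_int a' * (of_int a * z\<^sup>2 + of_int b * z + of_int c) - of_int a * (of_int a' * z\<^sup>2 + of_int b' * z + of_int c')"
    unfolding of_int_diff of_int_mult by Groebner_Basis.algebra
  also have "\<dots> = of_int 0 * z + of_int 0" by (simp only: z) simp
  finally have "a' * b - a * b' = 0 \<and> a' * c - a * c' = 0"
    using lattice_coords_unique[of z] assms(5) by (metis less_irrefl)
  then have e: "a' * b = a * b'" "a' * c = a * c'" by auto
  have "a'\<^sup>2 * D = (a' * b)\<^sup>2 - 4 * (a' * a) * (a' * c)"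
    unfolding assms(1)[symmetric] by (simp add: power2_eq_square algebra_simps)
  also have "\<dots> = a\<^sup>2 * D"
    unfolding e assms(2)[symmetric] by (simp add: power2_eq_square algebra_simps)
  finally have "a'\<^sup>2 = a\<^sup>2" using D_neg by simp
  then have "a' = a" using assms(3,4) by simp
  then show ?thesis using e assms(3) by simp
qed

end

section \<open>Ideals prime to the level\<close>

locale quad_order_level = quad_order +
  fixes N :: nat
  assumes N_pos: "N > 0"
begin

definition cong_R :: "complex \<Rightarrow> int \<Rightarrow> bool" where
  "cong_R \<nu> t \<longleftrightarrow> (\<exists>y\<in>R. \<nu> - of_int t = of_nat N * y)"

text \<open>Real elements of the order are integers, so N \<O> meets \<int> exactly in N
  \<int>.\<close>

lemma cong_R_of_int_iff: "cong_R (of_int s) t \<longleftrightarrow> [s = t] (mod int N)"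
proof
  assume "cong_R (of_int s) t"
  then obtain y where y: "y \<in> R" "of_int s - of_int t = of_nat N * y" by (auto simp: cong_R_def)
  have "Im (of_nat N * y) = 0" by (simp flip: y(2))
  then have "Im y = 0" using N_pos by simp
  with y(1) obtain k where "y = of_int k" by (rule R_real_imp_int)
  with y(2) have "of_int (s - t) = (of_int (int N * k) :: complex)" by simp
  then have "s - t = int N * k" by (simp only: of_int_eq_iff)
  then show "[s = t] (mod int N)" by (simp add: cong_iff_dvd_diff)
next
  assume "[s = t] (mod int N)"
  then obtain k where "s - t = int N * k" by (auto simp: cong_iff_dvd_diff)
  then have "of_int (s - t) = (of_int (int N * k) :: complex)" by (simp only:)
  then show "cong_R (of_int s) t" unfolding cong_R_def by (intro bexI[of _ "of_int k"]) auto
qed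

lemma cong_R_trans: "cong_R \<nu> s \<Longrightarrow> [s = t] (mod int N) \<Longrightarrow> cong_R \<nu> t"
proof -
  assume 1: "cong_R \<nu> s" "[s = t] (mod int N)"
  then have "cong_R (of_int s) t" by (simp add: cong_R_of_int_iff)
  with 1 obtain x y where "x \<in> R" "\<nu> - of_int s = of_nat N * x" "y \<in> R" "of_int s - of_int t = of_nat N * y"
    by (auto simp: cong_R_def)
  moreover have "\<nu> - of_int t = (\<nu> - of_int s) + (of_int s - of_int t)" by simp
  ultimately have "x + y \<in> R" "\<nu> - of_int t = of_nat N * (x + y)"
    by (simp_all only: distrib_left R_add)
  then show ?thesis unfolding cong_R_def by blast
qed

lemma cong_R_mem: "cong_R \<nu> t \<Longrightarrow> \<nu> \<in> R"
proof -
  assume "cong_R \<nu> t"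
  then obtain y where "y \<in> R" "\<nu> - of_int t = of_nat N * y" by (auto simp: cong_R_def)
  then have "\<nu> = of_nat N * y + of_int t" by (simp add: diff_eq_eq)
  then show ?thesis using \<open>y \<in> R\<close> by (simp add: R_add R_mult)
qed

lemma cong_R_mult: "cong_R \<mu> s \<Longrightarrow> cong_R \<nu> t \<Longrightarrow> cong_R (\<mu> * \<nu>) (s * t)"
proof -
  assume 1: "cong_R \<mu> s" "cong_R \<nu> t"
  then obtain x y where xy: "x \<in> R" "\<mu> - of_int s = of_nat N * x" "y \<in> R" "\<nu> - of_int t = of_nat N * y"
    by (auto simp: cong_R_def)
  have "\<mu> * \<nu> - of_int (s * t) = (\<mu> - of_int s) * \<nu> + of_int s * (\<nu> - of_int t)"
    unfolding of_int_mult by Groebner_Basis.algebra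
  also have "\<dots> = of_nat N * (x * \<nu> + of_int s * y)" unfolding xy by Groebner_Basis.algebra
  finally have "\<mu> * \<nu> - of_int (s * t) = of_nat N * (x * \<nu> + of_int s * y)" .
  moreover have "x * \<nu> + of_int s * y \<in> R" using xy cong_R_mem[OF 1(2)] by (intro R_add R_mult) auto
  ultimately show ?thesis unfolding cong_R_def by blast
qed

lemma cong_R_cnj: "cong_R \<nu> t \<Longrightarrow> cong_R (cnj \<nu>) t"
proof -
  assume "cong_R \<nu> t"
  then obtain y where y: "y \<in> R" "\<nu> - of_int t = of_nat N * y" by (auto simp: cong_R_def)
  have "cnj \<nu> - of_int t = of_nat N * cnj y" using arg_cong[OF y(2), of cnj] by simp
  then show ?thesis using y(1) unfolding cong_R_def by blast
qed

text \<open>Conjugation fixes \<open>t\<close> and maps N \<O> to itself, so both factors of the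
  norm have residue \<open>t\<close>.\<close>

lemma cong_R_norm:
  assumes "cong_R \<nu> t" "\<nu> * cnj \<nu> = of_int n"
  shows "[n = t * t] (mod int N)"
  using cong_R_mult[OF assms(1) cong_R_cnj[OF assms(1)]] by (simp only: assms(2) cong_R_of_int_iff)

text \<open>The explicit form of \<open>I(\<O>, N)\<close>; the equality is
  \<open>generate_level_ideals\<close>. The two conditions on \<open>m\<close> are dual: if B is the
  inverse of A, then m \<in> A gives m B \<subseteq> \<O>, and m A \<subseteq> \<O> gives m \<in> B.
  So the set is stable under inversion, with the same \<open>m\<close>.\<close>

definition level_ideals :: "complex set set" where
  "level_ideals = {A. proper A \<and>
     (\<exists>m>0. [m = 1] (mod int N) \<and> of_int m \<in> A \<and> (\<forall>x\<in>A. of_int m * x \<in> R))}"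

lemma level_idealsE:
  assumes "A \<in> level_ideals"
  obtains m where "m > 0" "[m = 1] (mod int N)" "of_int m \<in> A" "\<forall>x\<in>A. of_int m * x \<in> R"
  using assms unfolding level_ideals_def by auto

text \<open>Being prime to \<open>N\<close> provides an element of \<open>A\<close> congruent to 1,
  and its norm serves as \<open>m\<close>.\<close>

lemma integral_prime_to_in_level_ideals:
  assumes A: "proper A" "A \<subseteq> R" "prime_to R N A"
  shows "A \<in> level_ideals"
proof -
  have "\<exists>m>0. [m = 1] (mod int N) \<and> of_int m \<in> A"
  proof -
    obtain x where x: "x \<in> A" "x \<noteq> 0" "N = 1 \<or> cong_R x 1"
    \<comment> \<open>For \<open>N = 1\<close> the x in a decomposition 1 = x + N y might be 0 and
      have norm 0. Any nonzero element is taken instead, the congruence being void.\<close>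
    proof (cases "N = 1")
      case True
      then show ?thesis using fractional_ideal_nonzero[OF properD(1)[OF A(1)]] that by metis
    next
      case False
      have "1 \<in> {x + of_nat N * y | x y. x \<in> A \<and> y \<in> R}"
        using A(3) R_1 unfolding prime_to_def by simp
      then obtain x y where xy: "x \<in> A" "y \<in> R" "1 = x + of_nat N * y" by auto
      then have "x - of_int 1 = of_nat N * (- y)" "- y \<in> R"
        using R_diff[of 0 y] by (simp_all add: algebra_simps)
      then have c: "cong_R x 1" unfolding cong_R_def by blast
      have "x \<noteq> 0"
      proof
        assume "x = 0"
        then have "[0 = 1] (mod int N)" using c cong_R_of_int_iff[of 0 1] by simp
        then show False using False by (auto simp: cong_iff_dvd_diff)
      qed
      then show ?thesis using that c xy(1) by blast
    qed
    obtain n where n: "x * cnj x = of_int n" "n \<ge> 0" "n = 0 \<longleftrightarrow> x = 0"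
      using R_norm A(2) x(1) by blast
    have "[n = 1] (mod int N)" using x(3) cong_R_norm[OF _ n(1), of 1] by auto
    moreover have "cnj x * x \<in> A" using A x(1) by (intro properD(3)) auto
    ultimately show ?thesis using n x(2) by (intro exI[of _ n]) (auto simp: mult.commute)
  qed
  then show ?thesis using A(1,2) unfolding level_ideals_def by (auto intro!: R_mult)
qed

text \<open>The multiples of \<open>x\<close> realise every residue, since z is congruent to z x
  modulo \<open>N\<close>.\<close>

lemma prime_toI:
  assumes "A \<subseteq> R" "\<And>r x. r \<in> R \<Longrightarrow> x \<in> A \<Longrightarrow> r * x \<in> A" "x \<in> A" "cong_R x 1"
  shows "prime_to R N A"
proof -
  obtain y where y: "y \<in> R" "x - 1 = of_nat N * y" using assms(4) by (auto simp: cong_R_def)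
  have "\<exists>u v. z = u + of_nat N * v \<and> u \<in> A \<and> v \<in> R" if "z \<in> R" for z
  proof (intro exI conjI)
    have "1 = x - of_nat N * y" using y(2) by (simp add: algebra_simps)
    then have "z = z * (x - of_nat N * y)" by simp
    then show "z = z * x + of_nat N * (- (z * y))" by (simp add: right_diff_distrib mult.left_commute)
    show "z * x \<in> A" "- (z * y) \<in> R"
      using assms(2,3) that R_diff[of 0 "z * y"] y(1) R_mult by auto
  qed
  then show ?thesis using assms(1) unfolding prime_to_def by (auto intro!: R_add R_mult)
qed

lemma level_ideals_prime_to:
  assumes "A \<in> level_ideals" "A \<subseteq> R"
  shows "prime_to R N A"
proof -
  obtain m where m: "[m = 1] (mod int N)" "of_int m \<in> A" using assms(1) by (rule level_idealsE)
  have "proper A" using assms(1) by (simp add: level_ideals_def)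
  then show ?thesis
    using prime_toI[OF assms(2) properD(3) m(2)] m(1) by (simp add: cong_R_of_int_iff)
qed

lemma level_ideals_times:
  assumes "A \<in> level_ideals" "B \<in> level_ideals"
  shows "ideal_times A B \<in> level_ideals"
proof -
  obtain m where m: "m > 0" "[m = 1] (mod int N)" "of_int m \<in> A" "\<forall>x\<in>A. of_int m * x \<in> R"
    using assms(1) by (rule level_idealsE)
  obtain n where n: "n > 0" "[n = 1] (mod int N)" "of_int n \<in> B" "\<forall>x\<in>B. of_int n * x \<in> R"
    using assms(2) by (rule level_idealsE)
  have "of_int (m * n) * z \<in> R" if "z \<in> ideal_times A B" for z
  proof (rule ideal_times_mult_mem[OF that])
    fix x y assume "x \<in> A" "y \<in> B"
    then have "(of_int m * x) * (of_int n * y) \<in> R" using m(4) n(4) by (simp add: R_mult)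
    then show "of_int (m * n) * (x * y) \<in> R" by (simp add: ac_simps)
  qed simp
  moreover have "of_int (m * n) \<in> ideal_times A B" using ideal_timesI[OF m(3) n(3)] by simp
  moreover have "[m * n = 1] (mod int N)" using cong_mult[OF m(2) n(2)] by simp
  moreover have "m * n > 0" using m(1) n(1) by simp
  moreover have "proper (ideal_times A B)" using assms by (auto simp: level_ideals_def intro: proper_times)
  ultimately show ?thesis unfolding level_ideals_def by blast
qed

lemma level_ideals_inverse:
  assumes A: "A \<in> level_ideals" and B: "proper B" "ideal_times A B = R"
  shows "B \<in> level_ideals"
proof -
  obtain m where m: "m > 0" "[m = 1] (mod int N)" "of_int m \<in> A" "\<forall>x\<in>A. of_int m * x \<in> R"
    using A by (rule level_idealsE)
  \<comment> \<open>The product A B contains 1, and m carries A into the order, so m A B lies in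
    B.\<close>
  have "of_int m * 1 \<in> B"
  proof (rule ideal_times_mult_mem[of 1 A B])
    fix x y assume "x \<in> A" "y \<in> B"
    then have "of_int m * x * y \<in> B" using m(4) by (intro properD(3)[OF B(1)]) auto
    then show "of_int m * (x * y) \<in> B" by (simp add: mult.assoc)
  qed (use B properD in auto)
  moreover have "of_int m * x \<in> R" if "x \<in> B" for x
    using ideal_timesI[OF m(3) that] by (simp add: B(2))
  ultimately show ?thesis using m B(1) unfolding level_ideals_def by auto
qed

lemma R_in_level_ideals: "R \<in> level_ideals"
proof -
  have "proper R" using proper_principal[of 1] subsetD[OF R_subset_K R_1] by simp
  then show ?thesis by (auto simp: level_ideals_def intro!: exI[of _ 1])
qed

section \<open>The group of ideals prime to the level\<close>

lemma ideal_group_simps [simp]: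
  "carrier (ideal_group K R) = Collect proper" "mult (ideal_group K R) = ideal_times"
  "one (ideal_group K R) = R"
  by (simp_all add: ideal_group_def)

lemma subgroup_level_ideals: "subgroup level_ideals (ideal_group K R)"
proof -
  interpret comm_group "ideal_group K R" by (rule comm_group_ideal_group)
  show ?thesis
  proof (rule subgroupI)
    fix A assume A: "A \<in> level_ideals"
    then have "proper A" by (simp add: level_ideals_def)
    then obtain B where B: "proper B" "ideal_times A B = R" "ideal_times B A = R" by (rule proper_inverse)
    then have "inv\<^bsub>ideal_group K R\<^esub> A = B"
      using \<open>proper A\<close> by (intro inv_equality) auto
    then show "inv\<^bsub>ideal_group K R\<^esub> A \<in> level_ideals"
      using level_ideals_inverse[OF A B(1,2)] by simp
  next
    show "level_ideals \<noteq> {}" using R_in_level_ideals by blast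
    show "level_ideals \<subseteq> carrier (ideal_group K R)" by (auto simp: level_ideals_def)
  qed (simp add: level_ideals_times)
qed

lemma principal_of_int_in_level_ideals:
  assumes "m > 0" "[m = 1] (mod int N)"
  shows "principal_ideal R (of_int m) \<in> level_ideals"
proof (rule integral_prime_to_in_level_ideals)
  show "proper (principal_ideal R (of_int m))"
    using assms(1) subsetD[OF R_subset_K R_of_int] by (intro proper_principal) auto
  show "principal_ideal R (of_int m) \<subseteq> R" by (auto simp: mem_principal_ideal R_mult)
  then show "prime_to R N (principal_ideal R (of_int m))"
  proof (rule prime_toI)
    have "of_int m * 1 \<in> principal_ideal R (of_int m)" unfolding mem_principal_ideal using R_1 by blast
    then show "of_int m \<in> principal_ideal R (of_int m)" by simp
    show "cong_R (of_int m) 1" using assms(2) by (simp add: cong_R_of_int_iff)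
  qed (rule principal_ideal_closed[OF R_mult])
qed

text \<open>A member A is the quotient of the integral ideals m A and m \<O>. Both are prime to
  \<open>N\<close>: m \<O> lies in \<open>level_ideals\<close> by the choice of m, and then so does
  m A as a product.\<close>

lemma generate_level_ideals:
  "generate (ideal_group K R) {A. proper A \<and> A \<subseteq> R \<and> prime_to R N A} = level_ideals" (is "generate ?G ?S = _")
proof
  interpret comm_group ?G by (rule comm_group_ideal_group)
  show "generate ?G ?S \<subseteq> level_ideals"
    using integral_prime_to_in_level_ideals
    by (intro generate_subgroup_incl subgroup_level_ideals) auto
  show "level_ideals \<subseteq> generate ?G ?S"
  proof
    fix A assume A: "A \<in> level_ideals"
    then have "proper A" by (simp add: level_ideals_def)
    note clA = properD(3)[OF this]
    obtain m where m: "m > 0" "[m = 1] (mod int N)" "of_int m \<in> A" "\<forall>x\<in>A. of_int m * x \<in> R"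
      using A by (rule level_idealsE)
    define P where "P = principal_ideal R (of_int m)"
    have P: "P \<in> level_ideals" "P \<subseteq> R"
      using principal_of_int_in_level_ideals[OF m(1,2)] by (auto simp: P_def mem_principal_ideal R_mult)
    have PA: "ideal_times P A \<in> level_ideals" using P(1) A by (rule level_ideals_times)
    have "ideal_times P A \<subseteq> R"
      unfolding P_def using m(4) properD(2)[OF \<open>proper A\<close>] clA
      by (subst ideal_times_principal) (auto simp: mem_principal_ideal)
    then have 1: "ideal_times P A \<in> ?S" "P \<in> ?S"
      using PA P level_ideals_prime_to by (auto simp: level_ideals_def)
    have "inv\<^bsub>?G\<^esub> P \<otimes>\<^bsub>?G\<^esub> (P \<otimes>\<^bsub>?G\<^esub> A) = A"
      using 1 \<open>proper A\<close> by (intro inv_solve_left'[THEN iffD2]) auto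
    moreover have "inv\<^bsub>?G\<^esub> P \<otimes>\<^bsub>?G\<^esub> (P \<otimes>\<^bsub>?G\<^esub> A) \<in> generate ?G ?S"
      using generate.eng[OF generate.inv[OF 1(2)] generate.incl[OF 1(1)], of ?G] by simp
    ultimately show "A \<in> generate ?G ?S" by simp
  qed
qed

abbreviation \<I> where "\<I> \<equiv> ideal_group_prime_to K R N"

lemma level_group_simps [simp]:
  "carrier \<I> = level_ideals" "mult \<I> = ideal_times" "one \<I> = R"
  by (simp_all add: ideal_group_prime_to_def generate_level_ideals)

lemma comm_group_level: "comm_group \<I>"
proof -
  interpret comm_group "ideal_group K R" by (rule comm_group_ideal_group)
  have "\<I> = (ideal_group K R)\<lparr>carrier := level_ideals\<rparr>"
    by (simp add: ideal_group_prime_to_def generate_level_ideals)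
  then have "group \<I>" using subgroup_imp_group[OF subgroup_level_ideals] by (simp only:)
  then show ?thesis
    by (rule group.group_comm_groupI) (simp add: ideal_times_commute)
qed

text \<open>The integer a u serves as m, where u inverts \<open>a\<close> modulo \<open>N\<close>:
  the factor \<open>a\<close> carries \<omega> into the order, u adjusts the residue to 1, and 1
  belongs to the lattice.\<close>

lemma form_lattice_in_level_ideals:
  assumes Q: "Q \<in> forms D N"
  shows "form_lattice D Q \<in> level_ideals"
proof -
  obtain a b c where abc: "Q = (a, b, c)" by (cases Q)
  note Q = Q[unfolded abc]
  have "coprime a (int N)" and a: "a > 0" using Q by (auto simp: forms_def coprime_iff_gcd_eq_1)
  then obtain u where u: "u > 0" "[a * u = 1] (mod int N)" using pos_inverse_mod N_pos by metis
  have "1 \<in> form_lattice D Q" by (auto simp: form_lattice_def intro: int_mod.span_base)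
  from int_mod.subspace_scale[OF _ this, of "a * u"]
  have "of_int (a * u) \<in> form_lattice D Q" by (simp add: form_lattice_def)
  moreover have "of_int (a * u) * x \<in> R" if x: "x \<in> form_lattice D Q" for x
  proof -
    obtain i j where ij: "x = of_int i * form_root D Q + of_int j * 1"
      using x unfolding form_lattice_def span_pair_iff by blast
    have "of_int (a * u) * x = of_int (u * i) * (of_int a * form_root D Q) + of_int (a * u * j)"
      unfolding ij of_int_mult by Groebner_Basis.algebra
    moreover have "of_int a * form_root D Q \<in> R"
      unfolding R_form_basis[OF Q] abc by (rule int_mod.span_base) simp
    ultimately show ?thesis by (simp only: R_add R_mult R_of_int)
  qed
  moreover have "a * u > 0" using a u by simp
  ultimately show ?thesis
    using form_lattice_proper[OF Q] u(2) unfolding level_ideals_def abc by blast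
qed

end

section \<open>Congruence subgroups\<close>

lemma SL2Z_simps [simp]:
  "carrier SL2Z = {\<gamma>. det \<gamma> = 1}" "mult SL2Z = (**)" "one SL2Z = mat 1"
  by (simp_all add: SL2Z_def)

text \<open>The inverse in determinant 1, with explicit entries from which congruence conditions can
  be read off.\<close>

definition adjugate2 :: "int^2^2 \<Rightarrow> int^2^2" where
  "adjugate2 \<gamma> = vector [vector [\<gamma>$2$2, - \<gamma>$1$2], vector [- \<gamma>$2$1, \<gamma>$1$1]]"

lemma adjugate2_mult:
  assumes "det \<gamma> = 1"
  shows "adjugate2 \<gamma> ** \<gamma> = mat 1" "det (adjugate2 \<gamma>) = 1"
  using assms
  by (simp_all add: adjugate2_def det_2 vec_eq_iff forall_2 matrix_matrix_mult_def sum_2 mat_def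
      mult.commute)

lemma group_SL2Z: "group SL2Z"
proof (rule groupI)
  fix \<gamma> assume "\<gamma> \<in> carrier SL2Z"
  then show "\<exists>\<delta>\<in>carrier SL2Z. \<delta> \<otimes>\<^bsub>SL2Z\<^esub> \<gamma> = \<one>\<^bsub>SL2Z\<^esub>"
    using adjugate2_mult[of \<gamma>] by auto
qed (auto simp: det_mul matrix_mul_assoc)

lemma inv_SL2Z: "det \<gamma> = 1 \<Longrightarrow> inv\<^bsub>SL2Z\<^esub> \<gamma> = adjugate2 \<gamma>"
  using group.inv_equality[OF group_SL2Z, of "adjugate2 \<gamma>" \<gamma>] adjugate2_mult[of \<gamma>] by simp

text \<open>A form is determined by its values, so this reduces to associativity of matrices acting
  on vectors.\<close>

lemma form_act_mult: "form_act (form_act Q \<gamma>) \<delta> = form_act Q (\<gamma> ** \<delta>)"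
  by (rule form_eval_inject) (simp only: form_eval_act matrix_vector_mul_assoc)

lemma form_act_one: "form_act Q (mat 1) = Q"
  by (rule form_eval_inject) (simp only: form_eval_act matrix_vector_mul_lid)

lemma equiv_form_rel:
  assumes \<Gamma>: "subgroup \<Gamma> SL2Z"
  shows "equiv (forms D N) (form_rel D N \<Gamma>)"
proof (rule equivI)
  show "form_rel D N \<Gamma> \<subseteq> forms D N \<times> forms D N" by (auto simp: form_rel_def)
  show "refl_on (forms D N) (form_rel D N \<Gamma>)"
    using subgroup.one_closed[OF \<Gamma>] by (auto simp: refl_on_def form_rel_def form_act_one intro: bexI[of _ "mat 1"])
  show "sym (form_rel D N \<Gamma>)"
  proof (rule symI)
    fix Q Q' assume "(Q, Q') \<in> form_rel D N \<Gamma>"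
    then obtain \<gamma> where *: "Q \<in> forms D N" "Q' \<in> forms D N" "\<gamma> \<in> \<Gamma>" "Q' = form_act Q \<gamma>"
      by (auto simp: form_rel_def)
    let ?\<delta> = "inv\<^bsub>SL2Z\<^esub> \<gamma>"
    have "\<gamma> \<in> carrier SL2Z" using subgroup.mem_carrier[OF \<Gamma> *(3)] .
    then have "\<gamma> ** ?\<delta> = mat 1" using group.r_inv[OF group_SL2Z] by simp
    then have "Q = form_act Q' ?\<delta>" by (simp add: *(4) form_act_mult form_act_one)
    then show "(Q', Q) \<in> form_rel D N \<Gamma>"
      using * subgroup.m_inv_closed[OF \<Gamma> *(3)] by (auto simp: form_rel_def)
  qed
  show "trans (form_rel D N \<Gamma>)"
  proof (rule transI)
    fix Q Q' Q'' assume 1: "(Q, Q') \<in> form_rel D N \<Gamma>" "(Q', Q'') \<in> form_rel D N \<Gamma>"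
    then obtain \<gamma> \<delta> where *: "\<gamma> \<in> \<Gamma>" "Q' = form_act Q \<gamma>" "\<delta> \<in> \<Gamma>" "Q'' = form_act Q' \<delta>"
      by (auto simp: form_rel_def)
    then have "Q'' = form_act Q (\<gamma> ** \<delta>)" "\<gamma> ** \<delta> \<in> \<Gamma>"
      using subgroup.m_closed[OF \<Gamma>, of \<gamma> \<delta>] by (auto simp: form_act_mult)
    then show "(Q, Q'') \<in> form_rel D N \<Gamma>" using 1 by (auto simp: form_rel_def)
  qed
qed

section \<open>Bijections on quotients and equality of cosets\<close>

lemma bij_betw_quotient:
  fixes A :: "'a set" and r :: "('a \<times> 'a) set"
  assumes equiv: "equiv A r" and resp: "f respects r"
    and inj: "\<And>x y. x \<in> A \<Longrightarrow> y \<in> A \<Longrightarrow> f x = f y \<Longrightarrow> (x, y) \<in> r"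
    and surj: "f ` A = B"
  shows "bij_betw (\<lambda>C. the_elem (f ` C)) (A // r) B"
proof -
  \<comment> \<open>The image of a class under \<open>f\<close> is a singleton, so
    \<open>the_elem\<close> returns the common value.\<close>
  have eq: "the_elem (f ` (r `` {x})) = f x" if "x \<in> A" for x
  proof -
    have "x \<in> r `` {x}" using equiv that by (auto simp: equiv_def refl_on_def)
    moreover have "f y = f x" if "y \<in> r `` {x}" for y
      using congruentD[OF resp, of x y] that by auto
    ultimately have "f ` (r `` {x}) = {f x}" by blast
    then show ?thesis by simp
  qed
  show ?thesis
  proof (rule bij_betwI')
    fix C C' :: "'a set"
    assume C: "C \<in> A // r" and C': "C' \<in> A // r"
    obtain x where x: "x \<in> A" "C = r `` {x}" using C by (rule quotientE)
    obtain y where y: "y \<in> A" "C' = r `` {y}" using C' by (rule quotientE)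
    have "the_elem (f ` C) = f x" "the_elem (f ` C') = f y" using eq x y by simp_all
    then show "the_elem (f ` C) = the_elem (f ` C') \<longleftrightarrow> C = C'"
      using inj[OF x(1) y(1)] equiv_class_eq[OF equiv, of x y] x(2) y(2) by metis
  next
    fix C :: "'a set"
    assume "C \<in> A // r"
    then show "the_elem (f ` C) \<in> B" using surj by (auto simp: eq elim!: quotientE)
  next
    fix b assume "b \<in> B"
    then obtain x where "x \<in> A" "b = f x" using surj by auto
    then show "\<exists>C\<in>A // r. b = the_elem (f ` C)"
      by (intro bexI[of _ "r `` {x}"]) (simp_all add: eq quotientI)
  qed
qed

lemma (in group) r_coset_eq_iff:
  assumes "subgroup H G" "x \<in> carrier G" "y \<in> carrier G"
  shows "H #> x = H #> y \<longleftrightarrow> (\<exists>h\<in>H. y = h \<otimes> x)"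
proof -
  have "y \<in> H #> x \<longleftrightarrow> (\<exists>h\<in>H. y = h \<otimes> x)" by (auto simp: r_coset_def)
  then show ?thesis
    using repr_independence[OF _ assms(2,1)] repr_independenceD[OF assms(1,3)] by blast
qed


section \<open>Principal ideals generated by residues of a subgroup\<close>

text \<open>The predicate \<open>g t\<close> stands for \<open>t + N\<int> \<in> G\<close>, and \<open>PG\<close> for \<open>P\<^sub>G(\<O>, N)\<close>.\<close>

locale unit_level = quad_order_level +
  fixes g :: "int \<Rightarrow> bool"
  assumes g_1: "g 1"
    and g_mult: "g s \<Longrightarrow> g t \<Longrightarrow> g (s * t)"
    and g_cong: "g s \<Longrightarrow> [s = t] (mod int N) \<Longrightarrow> g t"
    and g_coprime: "g s \<Longrightarrow> coprime s (int N)"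
    and g_inv: "g s \<Longrightarrow> [s * t = 1] (mod int N) \<Longrightarrow> g t"
begin

definition PG :: "complex set set" where
  "PG = {principal_ideal R (\<nu> / of_int n) | \<nu> n. \<nu> \<noteq> 0 \<and> n > 0 \<and> g n \<and> (\<exists>t. g t \<and> cong_R \<nu> t)}"

lemma PGI: "\<nu> \<noteq> 0 \<Longrightarrow> n > 0 \<Longrightarrow> g n \<Longrightarrow> g t \<Longrightarrow> cong_R \<nu> t \<Longrightarrow> principal_ideal R (\<nu> / of_int n) \<in> PG"
  unfolding PG_def by blast

lemma PGE:
  assumes "A \<in> PG"
  obtains \<nu> n t where "A = principal_ideal R (\<nu> / of_int n)" "\<nu> \<noteq> 0" "n > 0" "g n" "g t" "cong_R \<nu> t"
  using assms unfolding PG_def by blast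

lemma g_inverse: assumes "g s" obtains u where "g u" "[s * u = 1] (mod int N)"
proof -
  obtain u where "[s * u = 1] (mod int N)"
    using cong_solve_coprime_int[OF g_coprime[OF assms]] by blast
  with g_inv[OF assms] that show ?thesis by blast
qed

text \<open>With u an inverse of \<open>t\<close> modulo \<open>N\<close>, the element \<nu> u of
  the ideal is congruent to 1.\<close>

lemma principal_cong:
  assumes "\<nu> \<noteq> 0" "cong_R \<nu> t" "g t"
  shows "principal_ideal R \<nu> \<in> level_ideals" "prime_to R N (principal_ideal R \<nu>)"
proof -
  have \<nu>: "\<nu> \<in> R" using assms(2) by (rule cong_R_mem)
  have sub: "principal_ideal R \<nu> \<subseteq> R" using \<nu> by (auto simp: mem_principal_ideal R_mult)
  obtain u where u: "[t * u = 1] (mod int N)" using g_inverse[OF assms(3)] by blast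
  have "\<nu> * of_int u \<in> principal_ideal R \<nu>" unfolding mem_principal_ideal using R_of_int by blast
  moreover have "cong_R (\<nu> * of_int u) 1"
    using cong_R_trans[OF cong_R_mult[OF assms(2), of "of_int u" u] u] by (simp add: cong_R_of_int_iff)
  ultimately show "prime_to R N (principal_ideal R \<nu>)"
    by (intro prime_toI[OF sub]) (auto intro: principal_ideal_closed[OF R_mult])
  moreover have "proper (principal_ideal R \<nu>)"
    using assms(1) \<nu> R_subset_K by (intro proper_principal) auto
  ultimately show "principal_ideal R \<nu> \<in> level_ideals"
    using sub integral_prime_to_in_level_ideals by blast
qed

lemma principal_inverse_in_level_ideals:
  assumes "principal_ideal R x \<in> level_ideals" "x \<in> K" "x \<noteq> 0"
  shows "principal_ideal R (inverse x) \<in> level_ideals"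
  using assms
  by (intro level_ideals_inverse[OF assms(1)] proper_principal) (auto simp: principal_times_principal)

lemma PG_subset: "PG \<subseteq> level_ideals"
proof
  fix A assume "A \<in> PG"
  then obtain \<nu> n t where A: "A = principal_ideal R (\<nu> / of_int n)" "\<nu> \<noteq> 0" "n > 0" "g n" "g t" "cong_R \<nu> t"
    by (rule PGE)
  have "principal_ideal R (of_int n) \<in> level_ideals"
    using A by (intro principal_cong(1)[of _ n]) (auto simp: cong_R_of_int_iff)
  then have "principal_ideal R (inverse (of_int n)) \<in> level_ideals"
    using A(3) R_subset_K by (intro principal_inverse_in_level_ideals) auto
  with principal_cong(1)[OF A(2,6,5)]
  have "ideal_times (principal_ideal R \<nu>) (principal_ideal R (inverse (of_int n))) \<in> level_ideals"
    by (rule level_ideals_times)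
  then show "A \<in> level_ideals" by (simp add: A(1) principal_times_principal divide_inverse)
qed

lemma inv_principal:
  assumes "principal_ideal R x \<in> level_ideals" "principal_ideal R y \<in> level_ideals" "x * y = 1"
  shows "inv\<^bsub>\<I>\<^esub> (principal_ideal R x) = principal_ideal R y"
proof -
  interpret comm_group \<I> by (rule comm_group_level)
  show ?thesis
    by (rule inv_equality) (use assms in \<open>auto simp: principal_times_principal mult.commute\<close>)
qed

lemma R_in_PG: "R \<in> PG"
  using PGI[of 1 1 1] g_1 cong_R_of_int_iff[of 1 1] by simp

lemma subgroup_PG: "subgroup PG \<I>"
proof -
  interpret comm_group \<I> by (rule comm_group_level)
  show ?thesis
  proof (rule subgroupI)
    show "PG \<subseteq> carrier \<I>" using PG_subset by simp
    show "PG \<noteq> {}" using R_in_PG by blast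
  next
    fix A assume "A \<in> PG"
    then obtain \<nu> n t where A: "A = principal_ideal R (\<nu> / of_int n)" "\<nu> \<noteq> 0" "n > 0" "g n" "g t" "cong_R \<nu> t"
      by (rule PGE)
    \<comment> \<open>The inverse of \<nu> / n is \<open>n * cnj \<nu> / k\<close> with k the norm
      of \<nu>. Its numerator has the residue of n t and its denominator that of t^2, and both
      residues satisfy \<open>g\<close>.\<close>
    obtain k where k: "\<nu> * cnj \<nu> = of_int k" "k \<ge> 0" "k = 0 \<longleftrightarrow> \<nu> = 0"
      using R_norm[OF cong_R_mem[OF A(6)]] .
    have "[k = t * t] (mod int N)" using cong_R_norm[OF A(6) k(1)] .
    then have "g k" using g_cong[OF g_mult[OF A(5,5)]] by (simp add: cong_sym)
    define y where "y = (of_int n * cnj \<nu>) / of_int k"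
    have "cong_R (of_int n * cnj \<nu>) (n * t)"
      using A(6) by (intro cong_R_mult cong_R_cnj) (simp_all add: cong_R_of_int_iff)
    then have "principal_ideal R y \<in> PG"
      unfolding y_def using A k g_mult[OF A(4,5)] \<open>g k\<close> by (intro PGI) auto
    moreover have "(\<nu> / of_int n) * y = (\<nu> * cnj \<nu>) / of_int k"
      using A(3) by (simp add: y_def)
    then have "(\<nu> / of_int n) * y = 1" using k A(2) by simp
    then have "inv\<^bsub>\<I>\<^esub> A = principal_ideal R y"
      unfolding A(1) using PG_subset \<open>A \<in> PG\<close> \<open>principal_ideal R y \<in> PG\<close> A(1) by (intro inv_principal) auto
    ultimately show "inv\<^bsub>\<I>\<^esub> A \<in> PG" by simp
  next
    fix A B assume "A \<in> PG" "B \<in> PG"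
    obtain \<nu> n t where A: "A = principal_ideal R (\<nu> / of_int n)" "\<nu> \<noteq> 0" "n > 0" "g n" "g t" "cong_R \<nu> t"
      using \<open>A \<in> PG\<close> by (rule PGE)
    obtain \<mu> m s where B: "B = principal_ideal R (\<mu> / of_int m)" "\<mu> \<noteq> 0" "m > 0" "g m" "g s" "cong_R \<mu> s"
      using \<open>B \<in> PG\<close> by (rule PGE)
    have "principal_ideal R ((\<nu> * \<mu>) / of_int (n * m)) \<in> PG"
      using A B g_mult cong_R_mult by (intro PGI[of _ _ "t * s"]) auto
    then show "A \<otimes>\<^bsub>\<I>\<^esub> B \<in> PG" by (simp add: A(1) B(1) principal_times_principal)
  qed
qed

text \<open>An integer n with \<open>g n\<close> itself generates one of the listed ideals, so
  (\<nu> / n) \<O> is a quotient of two generators.\<close>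

lemma generate_PG:
  "generate \<I> {principal_ideal R \<nu> | \<nu>. \<nu> \<in> R - {0} \<and>
     (\<exists>t. g t \<and> (\<exists>y\<in>R. \<nu> - of_int t = of_nat N * y))} = PG" (is "generate _ ?S = _")
proof
  interpret comm_group \<I> by (rule comm_group_level)
  have S: "?S = {principal_ideal R \<nu> | \<nu>. \<nu> \<noteq> 0 \<and> (\<exists>t. g t \<and> cong_R \<nu> t)}"
    using cong_R_mem unfolding cong_R_def by blast
  have "?S \<subseteq> PG"
  proof
    fix A assume "A \<in> ?S"
    then obtain \<nu> t where "A = principal_ideal R \<nu>" "\<nu> \<noteq> 0" "g t" "cong_R \<nu> t"
      unfolding S by blast
    then show "A \<in> PG" using PGI[of \<nu> 1 t] g_1 by simp
  qed
  then show "generate \<I> ?S \<subseteq> PG" by (intro generate_subgroup_incl subgroup_PG)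
  show "PG \<subseteq> generate \<I> ?S"
  proof
    fix A assume "A \<in> PG"
    then obtain \<nu> n t where A: "A = principal_ideal R (\<nu> / of_int n)" "\<nu> \<noteq> 0" "n > 0" "g n" "g t" "cong_R \<nu> t"
      by (rule PGE)
    let ?P = "principal_ideal R \<nu>" and ?Q = "principal_ideal R (of_int n)"
    have n: "cong_R (of_int n) n" by (simp add: cong_R_of_int_iff)
    have "?P \<in> ?S" unfolding S using A by blast
    moreover have "of_int n \<noteq> (0::complex)" using A(3) by simp
    then have "?Q \<in> ?S" unfolding S using A(4) n by blast
    ultimately have "?P \<otimes>\<^bsub>\<I>\<^esub> inv\<^bsub>\<I>\<^esub> ?Q \<in> generate \<I> ?S"
      by (intro generate.eng generate.inv generate.incl)
    moreover have Q: "?Q \<in> level_ideals"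
      using A n by (intro principal_cong(1)) auto
    then have "principal_ideal R (inverse (of_int n)) \<in> level_ideals"
      using A(3) R_subset_K by (intro principal_inverse_in_level_ideals) auto
    then have "inv\<^bsub>\<I>\<^esub> ?Q = principal_ideal R (inverse (of_int n))"
      using Q A(3) by (intro inv_principal) auto
    ultimately show "A \<in> generate \<I> ?S"
      by (simp add: A(1) principal_times_principal divide_inverse)
  qed
qed

end

section \<open>Equivalent forms have homothetic lattices\<close>

context quad_order
begin

text \<open>Trace and norm of an integral multiple of \<omega> give an equation for \<omega>, made
  primitive by dividing out its content. Primitivity makes [a \<omega>, 1] the multiplier ring of
  the lattice, and invertibility makes that ring the order; the discriminant computed from this
  basis is therefore \<open>D\<close>.\<close>

lemma lattice_form:
  assumes A: "proper (int_mod.span {\<omega>, 1})" and \<omega>: "Im \<omega> > 0"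
  obtains a b c where "gcd a (gcd b c) = 1" "a > 0" "b\<^sup>2 - 4 * a * c = D"
    "\<omega> = form_root D (a, b, c)" "R = int_mod.span {of_int a * \<omega>, 1}"
proof -
  let ?A = "int_mod.span {\<omega>, 1}"
  have \<omega>A: "\<omega> \<in> ?A" "1 \<in> ?A" by (auto intro: int_mod.span_base)
  then have "\<omega> \<in> K" using properD(1)[OF A] unfolding fractional_ideal_def by blast
  then obtain k where k: "k > 0" "of_int k * \<omega> \<in> R" using K_denominator by blast
  obtain t where t: "of_int k * \<omega> + cnj (of_int k * \<omega>) = of_int t" using R_trace[OF k(2)] .
  obtain n where n: "(of_int k * \<omega>) * cnj (of_int k * \<omega>) = of_int n" using R_norm[OF k(2)] by blast
  \<comment> \<open>The content of k^2 X^2 - k t X + n, a polynomial vanishing at \<omega>.\<close>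
  define d where "d = gcd (k\<^sup>2) (gcd (- k * t) n)"
  have "d > 0" using k(1) by (simp add: d_def)
  have "d dvd k\<^sup>2" "d dvd - k * t" "d dvd n"
    unfolding d_def by (meson gcd_dvd1 gcd_dvd2 dvd_trans)+
  then obtain a b c where abc: "k\<^sup>2 = d * a" "- k * t = d * b" "n = d * c"
    unfolding dvd_def by blast
  have mult_gcd: "gcd (d * x) (d * y) = d * gcd x y" for x y
    using gcd_mult_distrib_int[of d x y] \<open>d > 0\<close> by simp
  have "d * gcd a (gcd b c) = gcd (k\<^sup>2) (gcd (- k * t) n)"
    by (simp only: abc mult_gcd)
  then have "d * gcd a (gcd b c) = d" by (simp only: d_def)
  then have g: "gcd a (gcd b c) = 1" using \<open>d > 0\<close> by simp
  have "d * a > 0" using k(1) unfolding abc(1)[symmetric] by simp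
  then have a: "a > 0" using \<open>d > 0\<close> by (simp add: zero_less_mult_iff)
  have "of_int d * (of_int a * \<omega>\<^sup>2 + of_int b * \<omega> + of_int c)
      = of_int (d * a) * \<omega>\<^sup>2 + of_int (d * b) * \<omega> + of_int (d * c)"
    unfolding of_int_mult by Groebner_Basis.algebra
  also have "\<dots> = (of_int k * \<omega>)\<^sup>2 - of_int t * (of_int k * \<omega>) + of_int n"
    unfolding abc[symmetric] of_int_mult of_int_minus of_int_power by Groebner_Basis.algebra
  also have "\<dots> = 0" unfolding t[symmetric] n[symmetric] by Groebner_Basis.algebra
  finally have root: "of_int a * \<omega>\<^sup>2 + of_int b * \<omega> + of_int c = 0" using \<open>d > 0\<close> by simp
  have a\<omega>2: "of_int a * \<omega> * \<omega> = of_int (- b) * \<omega> + of_int (- c) * 1"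
  proof -
    have "of_int a * \<omega> * \<omega> = (of_int a * \<omega>\<^sup>2 + of_int b * \<omega> + of_int c) + (of_int (- b) * \<omega> + of_int (- c) * 1)"
      unfolding of_int_minus by Groebner_Basis.algebra
    then show ?thesis by (simp only: root add_0_left)
  qed
  have R: "R = int_mod.span {of_int a * \<omega>, 1}"
  proof
    show "R \<subseteq> int_mod.span {of_int a * \<omega>, 1}"
    proof
      fix x assume x: "x \<in> R"
      have "x * 1 \<in> ?A" "x * \<omega> \<in> ?A" using properD(3)[OF A x] \<omega>A by blast+
      then obtain i j k l where 1: "x = of_int i * \<omega> + of_int j * 1"
        and 2: "x * \<omega> = of_int k * \<omega> + of_int l * 1"
        unfolding span_pair_iff by auto
      \<comment> \<open>Two expansions of a x \<omega> in the basis \<omega>, 1 are compared. They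
        show that \<open>a\<close> divides i b and i c, hence \<open>i\<close>, since the form is
        primitive.\<close>
      have "of_int (a * k) * \<omega> + of_int (a * l) = of_int a * (x * \<omega>)"
        unfolding 2 of_int_mult by Groebner_Basis.algebra
      also have "\<dots> = of_int i * (of_int a * \<omega> * \<omega>) + of_int (a * j) * \<omega>"
        unfolding 1 of_int_mult by Groebner_Basis.algebra
      also have "\<dots> = of_int (a * j - i * b) * \<omega> + of_int (- i * c)"
        unfolding a\<omega>2 of_int_mult of_int_minus of_int_diff by Groebner_Basis.algebra
      finally have "of_int (a * k) * \<omega> + of_int (a * l) = of_int (a * j - i * b) * \<omega> + of_int (- i * c)" .
      moreover have "Im \<omega> \<noteq> 0" using \<omega> by simp
      ultimately have "a * k = a * j - i * b" "a * l = - i * c"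
        using lattice_coords_unique by blast+
      then have "i * b = a * (j - k)" "i * c = a * (- l)" by (simp_all add: right_diff_distrib)
      then have "a dvd gcd (i * b) (i * c)" by (intro gcd_greatest) auto
      then have "a dvd i * gcd b c" by (cases "i \<ge> 0") (simp_all flip: gcd_mult_distrib_int)
      moreover have "coprime a (gcd b c)" using g by (simp only: coprime_iff_gcd_eq_1)
      ultimately have "a dvd i" by (simp only: coprime_dvd_mult_left_iff)
      then obtain i' where "i = a * i'" by blast
      then have "x = of_int i' * (of_int a * \<omega>) + of_int j * 1" by (simp add: 1)
      then show "x \<in> int_mod.span {of_int a * \<omega>, 1}" unfolding span_pair_iff by blast
    qed
    have "of_int a * \<omega> \<in> R"
    proof (rule multiplier_in_R[OF A])
      fix z assume "z \<in> ?A"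
      then obtain i j where z: "z = of_int i * \<omega> + of_int j * 1" unfolding span_pair_iff by blast
      have "of_int a * \<omega> * z = of_int i * (of_int a * \<omega> * \<omega>) + of_int (a * j) * \<omega>"
        unfolding z of_int_mult by Groebner_Basis.algebra
      also have "\<dots> = of_int (a * j - i * b) * \<omega> + of_int (- i * c) * 1"
        unfolding a\<omega>2 of_int_mult of_int_minus of_int_diff by Groebner_Basis.algebra
      finally show "of_int a * \<omega> * z \<in> ?A" unfolding span_pair_iff by blast
    qed
    then show "int_mod.span {of_int a * \<omega>, 1} \<subseteq> R" by (intro int_mod.span_minimal) auto
  qed
  \<comment> \<open>The conjugate is the second root: subtracting the two equations and cancelling
    \<open>\<omega> - cnj \<omega>\<close> gives the sum of the roots.\<close>
  have "of_int a * cnj \<omega> = - of_int b - of_int a * \<omega>"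
  proof -
    have "of_int a * (cnj \<omega>)\<^sup>2 + of_int b * cnj \<omega> + of_int c = 0"
      using arg_cong[OF root, of cnj] by simp
    moreover have "(\<omega> - cnj \<omega>) * (of_int a * cnj \<omega> - (- of_int b - of_int a * \<omega>))
        = (of_int a * \<omega>\<^sup>2 + of_int b * \<omega> + of_int c) - (of_int a * (cnj \<omega>)\<^sup>2 + of_int b * cnj \<omega> + of_int c)"
      by Groebner_Basis.algebra
    moreover have "\<omega> \<noteq> cnj \<omega>" using \<omega> by (auto simp: complex_eq_iff)
    ultimately show ?thesis using root by (metis diff_0_right eq_iff_diff_eq_0 mult_eq_0_iff)
  qed
  then have "of_int a * \<omega> * cnj 1 - cnj (of_int a * \<omega>) * 1 = 2 * of_int a * \<omega> + of_int b"
    by simp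
  moreover have "(2 * of_int a * \<omega> + of_int b)\<^sup>2
      = 4 * of_int a * (of_int a * \<omega>\<^sup>2 + of_int b * \<omega> + of_int c) + of_int (b\<^sup>2 - 4 * a * c)"
    unfolding of_int_diff of_int_mult of_int_power of_int_numeral by Groebner_Basis.algebra
  ultimately have "of_int (b\<^sup>2 - 4 * a * c) = (of_int a * \<omega> * cnj 1 - cnj (of_int a * \<omega>) * 1)\<^sup>2"
    by (simp only: root mult_zero_right add_0_left)
  then have "order_discriminant R = b\<^sup>2 - 4 * a * c"
    using a \<omega> by (intro order_discriminant_eqI[OF R]) auto
  then have D: "b\<^sup>2 - 4 * a * c = D" by (simp add: order_discriminant_R)
  show ?thesis using that[OF g a D _ R] form_root_unique[OF D a \<omega> root] by simp
qed

text \<open>With \<alpha> = p \<omega>' + q and \<mu> = r \<omega>' + s, the identity Q(\<alpha>,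
  \<mu>) = Q'(\<omega>', 1) = 0 makes \<alpha> / \<mu> a root of Q. Determinant 1 keeps it in the
  upper half-plane, so it is \<omega>.\<close>

lemma form_root_act:
  fixes \<gamma> :: "int^2^2"
  assumes Q: "(a, b, c) \<in> forms D N" and Q': "(a', b', c') \<in> forms D N"
    and eq: "(a', b', c') = form_act (a, b, c) \<gamma>" and det: "det \<gamma> = 1"
  defines "\<omega> \<equiv> form_root D (a, b, c)" and "\<omega>' \<equiv> form_root D (a', b', c')"
  defines "\<mu> \<equiv> of_int (\<gamma>$2$1) * \<omega>' + of_int (\<gamma>$2$2)"
  shows "\<mu> \<noteq> 0" "\<mu> * \<omega> = of_int (\<gamma>$1$1) * \<omega>' + of_int (\<gamma>$1$2)"
proof -
  define p q r s where pqrs: "p = \<gamma>$1$1" "q = \<gamma>$1$2" "r = \<gamma>$2$1" "s = \<gamma>$2$2"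
  have det: "p * s - q * r = 1" using det by (simp add: det_2 pqrs)
  have \<mu>: "\<mu> = of_int r * \<omega>' + of_int s * 1" by (simp add: \<mu>_def pqrs)
  define \<alpha> where "\<alpha> = of_int p * \<omega>' + of_int q * 1"
  have Im: "Im (\<alpha> * cnj \<mu>) = Im \<omega>'"
    using Im_basis_change[of p \<omega>' q 1 r s] by (simp add: \<mu> \<alpha>_def det)
  moreover have \<omega>': "Im \<omega>' > 0" unfolding \<omega>'_def by (rule Im_form_root[OF Q'])
  ultimately show "\<mu> \<noteq> 0" by auto
  have abc': "a' = a * p\<^sup>2 + b * p * r + c * r\<^sup>2" "b' = 2 * a * p * q + b * (p * s + q * r) + 2 * c * r * s"
    "c' = a * q\<^sup>2 + b * q * s + c * s\<^sup>2"
    using eq by (simp_all add: Let_def pqrs)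
  have root: "of_int a' * \<omega>'\<^sup>2 + of_int b' * \<omega>' + of_int c' = 0"
    using form_root_conj(3)[OF Q' meta_eq_to_obj_eq[OF \<omega>'_def]] .
  have "of_int a * \<alpha>\<^sup>2 + of_int b * \<alpha> * \<mu> + of_int c * \<mu>\<^sup>2
      = of_int a' * \<omega>'\<^sup>2 + of_int b' * \<omega>' + of_int c'"
    unfolding abc' \<alpha>_def \<mu> of_int_add of_int_mult of_int_power of_int_numeral by Groebner_Basis.algebra
  then have "(of_int a * \<alpha>\<^sup>2 + of_int b * \<alpha> * \<mu> + of_int c * \<mu>\<^sup>2) / \<mu>\<^sup>2 = 0" by (simp only: root) simp
  moreover have "(of_int a * \<alpha>\<^sup>2 + of_int b * \<alpha> * \<mu> + of_int c * \<mu>\<^sup>2) / \<mu>\<^sup>2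
      = of_int a * (\<alpha> / \<mu>)\<^sup>2 + of_int b * (\<alpha> / \<mu>) + of_int c"
    using \<open>\<mu> \<noteq> 0\<close> by (simp add: add_divide_distrib power_divide power2_eq_square)
  ultimately have "of_int a * (\<alpha> / \<mu>)\<^sup>2 + of_int b * (\<alpha> / \<mu>) + of_int c = 0" by simp
  moreover have "Im (\<alpha> / \<mu>) > 0"
    using Im \<omega>' by (simp add: Im_complex_div_gt_0)
  ultimately have "form_root D (a, b, c) = \<alpha> / \<mu>"
    using Q by (intro form_root_unique) (auto simp: forms_def)
  then show "\<mu> * \<omega> = of_int (\<gamma>$1$1) * \<omega>' + of_int (\<gamma>$1$2)"
    using \<open>\<mu> \<noteq> 0\<close> by (simp add: \<omega>_def \<alpha>_def pqrs)
qed

lemma form_lattice_act: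
  fixes \<gamma> :: "int^2^2"
  assumes Q: "(a, b, c) \<in> forms D N" and Q': "(a', b', c') \<in> forms D N"
    and eq: "(a', b', c') = form_act (a, b, c) \<gamma>" and det: "det \<gamma> = 1"
  shows "form_lattice D (a', b', c') = principal_ideal (form_lattice D (a, b, c))
    (of_int (\<gamma>$2$1) * form_root D (a', b', c') + of_int (\<gamma>$2$2))"
proof -
  have "\<gamma>$1$1 * \<gamma>$2$2 - \<gamma>$1$2 * \<gamma>$2$1 = 1" using det by (simp add: det_2)
  from span_unimodular[OF this, of "form_root D (a', b', c')" 1] show ?thesis
    unfolding form_lattice_def principal_ideal_span_pair form_root_act(2)[OF assms] by simp
qed

text \<open>The base change taken from the homothety is shown to have determinant 1. The transformed
  form then has discriminant \<open>D\<close>, positive leading coefficient and root \<omega>', so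
  \<open>form_ext\<close> identifies it. The last equation records the scaling factor, from which
  the congruence conditions on \<gamma> will be extracted.\<close>

lemma homothetic_form_lattices:
  assumes Q: "(a, b, c) \<in> forms D N" and Q': "(a', b', c') \<in> forms D N"
    and eq: "form_lattice D (a, b, c) = principal_ideal (form_lattice D (a', b', c')) \<mu>"
  obtains \<gamma> :: "int^2^2" where "det \<gamma> = 1" "(a', b', c') = form_act (a, b, c) \<gamma>"
    "\<mu> * (of_int (\<gamma>$2$1) * form_root D (a', b', c') + of_int (\<gamma>$2$2)) = 1"
proof -
  define \<omega> \<omega>' where \<omega>: "\<omega> = form_root D (a, b, c)" and \<omega>': "\<omega>' = form_root D (a', b', c')"
  have Im: "Im \<omega> > 0" "Im \<omega>' > 0" using Im_form_root Q Q' by (auto simp: \<omega> \<omega>')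
  have span: "int_mod.span {\<omega>, 1} = int_mod.span {\<mu> * \<omega>', \<mu> * 1}"
    using eq unfolding form_lattice_def principal_ideal_span_pair \<omega> \<omega>' .
  have "Im (\<omega> * cnj 1) \<noteq> 0" using Im by simp
  from lattice_basis_change[OF span this] obtain p q r s where 1: "\<omega> = of_int p * (\<mu> * \<omega>') + of_int q * (\<mu> * 1)"
    "1 = of_int r * (\<mu> * \<omega>') + of_int s * (\<mu> * 1)" and det: "p * s - q * r = 1 \<or> p * s - q * r = -1"
    by blast
  \<comment> \<open>Oriented areas of the two bases are compared; the common factor \<mu>
    contributes only the square of \<open>cmod \<mu>\<close>, which cannot change a sign.\<close>
  have "Im \<omega> = Im (\<omega> * cnj 1)" by simp
  also have "\<dots> = of_int (p * s - q * r) * Im (\<mu> * \<omega>' * cnj (\<mu> * 1))"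
    by (subst (1) 1(1), subst (1) 1(2)) (rule Im_basis_change)
  also have "\<mu> * \<omega>' * cnj (\<mu> * 1) = of_real ((cmod \<mu>)\<^sup>2) * \<omega>'"
    unfolding complex_norm_square by simp
  finally have Im_eq: "Im \<omega> = of_int (p * s - q * r) * ((cmod \<mu>)\<^sup>2 * Im \<omega>')"
    by (simp del: of_real_power)
  have det: "p * s - q * r = 1"
  proof (rule ccontr)
    assume "p * s - q * r \<noteq> 1"
    then have e: "p * s - q * r = -1" using det by simp
    have "Im \<omega> = - ((cmod \<mu>)\<^sup>2 * Im \<omega>')" using Im_eq unfolding e by simp
    moreover have "(cmod \<mu>)\<^sup>2 * Im \<omega>' \<ge> 0" using Im by simp
    ultimately show False using Im(1) by linarith
  qed
  define \<alpha> \<beta> where \<alpha>: "\<alpha> = of_int p * \<omega>' + of_int q" and \<beta>: "\<beta> = of_int r * \<omega>' + of_int s"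
  have 2: "\<omega> = \<mu> * \<alpha>" "1 = \<mu> * \<beta>"
    using 1 by (simp_all add: \<alpha> \<beta> distrib_left mult.left_commute mult.commute)
  define \<gamma> :: "int^2^2" where "\<gamma> = vector [vector [p, q], vector [r, s]]"
  have \<gamma>: "\<gamma>$1$1 = p" "\<gamma>$1$2 = q" "\<gamma>$2$1 = r" "\<gamma>$2$2 = s" by (simp_all add: \<gamma>_def)
  define A B C where ABC: "A = a * p\<^sup>2 + b * p * r + c * r\<^sup>2"
    "B = 2 * a * p * q + b * (p * s + q * r) + 2 * c * r * s" "C = a * q\<^sup>2 + b * q * s + c * s\<^sup>2"
  have act: "form_act (a, b, c) \<gamma> = (A, B, C)" by (simp add: \<gamma> ABC Let_def)
  have Qd: "b\<^sup>2 - 4 * a * c = D" "a > 0" and Q'd: "b'\<^sup>2 - 4 * a' * c' = D" "a' > 0"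
    using Q Q' by (auto simp: forms_def)
  have "B\<^sup>2 - 4 * A * C = (p * s - q * r)\<^sup>2 * (b\<^sup>2 - 4 * a * c)"
    unfolding ABC by Groebner_Basis.algebra
  then have disc: "B\<^sup>2 - 4 * A * C = D" by (simp add: det Qd)
  \<comment> \<open>Completing the square shows that the form is positive definite, so its value
    \<open>A\<close> at the nonzero vector (p, r) is positive.\<close>
  have "4 * a * A = (2 * a * p + b * r)\<^sup>2 - (b\<^sup>2 - 4 * a * c) * r\<^sup>2"
    unfolding ABC by Groebner_Basis.algebra
  then have 3: "4 * a * A = (2 * a * p + b * r)\<^sup>2 + (- D) * r\<^sup>2" by (simp add: Qd)
  have "(2 * a * p + b * r)\<^sup>2 + (- D) * r\<^sup>2 > 0"
  proof (cases "r = 0")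
    case True
    then have "p \<noteq> 0" using det by auto
    then show ?thesis using True Qd(2) by simp
  next
    case False
    then have "(- D) * r\<^sup>2 > 0" using D_neg by (intro mult_pos_pos) auto
    then show ?thesis by (intro add_nonneg_pos) auto
  qed
  then have "4 * a * A > 0" using 3 by simp
  then have A: "A > 0" using Qd(2) by (simp add: zero_less_mult_iff)
  \<comment> \<open>The new form at (\<omega>', 1) is the old one at (\<alpha>, \<beta>), which is
    (\<omega>, 1) divided by \<mu>.\<close>
  have "of_int A * \<omega>'\<^sup>2 + of_int B * \<omega>' + of_int C = of_int a * \<alpha>\<^sup>2 + of_int b * \<alpha> * \<beta> + of_int c * \<beta>\<^sup>2"
    unfolding ABC \<alpha> \<beta> of_int_add of_int_mult of_int_power of_int_numeral by Groebner_Basis.algebra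
  also have "\<mu>\<^sup>2 * \<dots> = of_int a * (\<mu> * \<alpha>)\<^sup>2 + of_int b * (\<mu> * \<alpha>) * (\<mu> * \<beta>) + of_int c * (\<mu> * \<beta>)\<^sup>2"
    by Groebner_Basis.algebra
  also have "\<dots> = of_int a * \<omega>\<^sup>2 + of_int b * \<omega> + of_int c"
    unfolding 2(1)[symmetric] 2(2)[symmetric] by simp
  also have "\<dots> = 0" by (rule form_root_conj(3)[OF Q \<omega>])
  finally have "of_int A * \<omega>'\<^sup>2 + of_int B * \<omega>' + of_int C = 0" using 2(2) by auto
  then have "(A, B, C) = (a', b', c')"
    using form_root_conj(3)[OF Q' \<omega>'] by (intro form_ext[OF disc Q'd(1) A Q'd(2) Im(2)])
  then show ?thesis
    using that[of \<gamma>] act det 2(2) by (simp add: det_2 \<gamma> \<beta> \<omega>')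
qed

end

context unit_level
begin

text \<open>\<open>Gamma_in\<close> without its auxiliary integer t: as \<open>g\<close> depends
  only on the residue, t may be taken to be the upper left entry.\<close>

definition \<Gamma> :: "(int^2^2) set" where
  "\<Gamma> = {\<gamma>. det \<gamma> = 1 \<and> g (\<gamma>$1$1) \<and> [\<gamma>$2$1 = 0] (mod int N)}"

text \<open>Modulo \<open>N\<close> the matrix is upper triangular, so its determinant is the
  product of the diagonal entries.\<close>

lemma \<Gamma>_diagonal:
  fixes \<gamma> :: "int^2^2"
  assumes "\<gamma> \<in> \<Gamma>"
  shows "[\<gamma>$1$1 * \<gamma>$2$2 = 1] (mod int N)" "g (\<gamma>$2$2)"
proof -
  have "\<gamma>$1$1 * \<gamma>$2$2 = 1 + \<gamma>$1$2 * \<gamma>$2$1" and 0: "[\<gamma>$2$1 = 0] (mod int N)"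
    using assms by (auto simp: \<Gamma>_def det_2)
  moreover have "[1 + \<gamma>$1$2 * \<gamma>$2$1 = 1 + \<gamma>$1$2 * 0] (mod int N)"
    using 0 by (intro cong_add cong_mult cong_refl)
  ultimately show 1: "[\<gamma>$1$1 * \<gamma>$2$2 = 1] (mod int N)" by simp
  show "g (\<gamma>$2$2)" using g_inv[OF _ 1] assms by (simp add: \<Gamma>_def)
qed

lemma subgroup_\<Gamma>: "subgroup \<Gamma> SL2Z"
proof -
  interpret group SL2Z by (rule group_SL2Z)
  show ?thesis
  proof (rule subgroupI)
    show "\<Gamma> \<subseteq> carrier SL2Z" by (auto simp: \<Gamma>_def)
    have "(mat 1 :: int^2^2)$1$1 = 1" "(mat 1 :: int^2^2)$2$1 = 0" by (simp_all add: mat_def)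
    then have "mat 1 \<in> \<Gamma>" by (simp add: \<Gamma>_def g_1)
    then show "\<Gamma> \<noteq> {}" by blast
  next
    fix \<gamma> assume \<gamma>: "\<gamma> \<in> \<Gamma>"
    then have "det \<gamma> = 1" by (simp add: \<Gamma>_def)
    moreover have "adjugate2 \<gamma> \<in> \<Gamma>"
      using adjugate2_mult(2)[OF \<open>det \<gamma> = 1\<close>] \<Gamma>_diagonal(2)[OF \<gamma>] \<gamma>
      by (simp add: \<Gamma>_def adjugate2_def cong_0_iff)
    ultimately show "inv\<^bsub>SL2Z\<^esub> \<gamma> \<in> \<Gamma>" by (simp add: inv_SL2Z)
  next
    fix \<gamma> \<delta> assume \<gamma>: "\<gamma> \<in> \<Gamma>" and \<delta>: "\<delta> \<in> \<Gamma>"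
    have e: "(\<gamma> ** \<delta>)$1$1 = \<gamma>$1$1 * \<delta>$1$1 + \<gamma>$1$2 * \<delta>$2$1" "(\<gamma> ** \<delta>)$2$1 = \<gamma>$2$1 * \<delta>$1$1 + \<gamma>$2$2 * \<delta>$2$1"
      by (simp_all add: matrix_matrix_mult_def sum_2)
    have z: "int N dvd \<gamma>$2$1" "int N dvd \<delta>$2$1" using \<gamma> \<delta> by (auto simp: \<Gamma>_def cong_0_iff)
    have "g (\<gamma>$1$1 * \<delta>$1$1)" using \<gamma> \<delta> by (auto simp: \<Gamma>_def intro: g_mult)
    moreover have "[\<gamma>$1$1 * \<delta>$1$1 = (\<gamma> ** \<delta>)$1$1] (mod int N)"
      using z by (simp add: e cong_iff_dvd_diff)
    ultimately have "g ((\<gamma> ** \<delta>)$1$1)" by (rule g_cong)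
    moreover have "[(\<gamma> ** \<delta>)$2$1 = 0] (mod int N)" using z by (simp add: e cong_0_iff)
    ultimately show "\<gamma> \<otimes>\<^bsub>SL2Z\<^esub> \<delta> \<in> \<Gamma>" using \<gamma> \<delta> by (simp add: \<Gamma>_def det_mul)
  qed
qed

text \<open>
  Up to an integer congruent to 1, the factor of homothety between two \<open>\<Gamma>\<close>-equivalent forms is
  integral and congruent to the lower right entry of the matrix.
\<close>

lemma form_lattice_act_PG:
  assumes Q: "Q \<in> forms D N" and Q': "form_act Q \<gamma> \<in> forms D N" and \<gamma>: "\<gamma> \<in> \<Gamma>"
  shows "\<exists>P\<in>PG. form_lattice D (form_act Q \<gamma>) = ideal_times P (form_lattice D Q)"
proof -
  obtain a b c where abc: "Q = (a, b, c)" by (cases Q)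
  obtain a' b' c' where abc': "form_act Q \<gamma> = (a', b', c')" by (cases "form_act Q \<gamma>")
  have det: "det \<gamma> = 1" using \<gamma> by (simp add: \<Gamma>_def)
  note act = Q[unfolded abc] Q'[unfolded abc'] abc'[unfolded abc, symmetric] det
  define \<omega>' where "\<omega>' = form_root D (a', b', c')"
  define r s where rs: "r = \<gamma>$2$1" "s = \<gamma>$2$2"
  define \<mu> where "\<mu> = of_int r * \<omega>' + of_int s"
  have \<mu>: "\<mu> \<noteq> 0" using form_root_act(1)[OF act] by (simp add: \<mu>_def rs \<omega>'_def)
  have L: "form_lattice D (form_act Q \<gamma>) = principal_ideal (form_lattice D Q) \<mu>"
    using form_lattice_act[OF act] unfolding abc' unfolding abc \<mu>_def rs \<omega>'_def .
  have "coprime a' (int N)" and a': "a' > 0"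
    using act(2) by (auto simp: forms_def coprime_iff_gcd_eq_1)
  then obtain u where u: "u > 0" "[a' * u = 1] (mod int N)" using pos_inverse_mod N_pos by metis
  obtain k where k: "r = int N * k" using \<gamma> by (auto simp: \<Gamma>_def rs cong_0_iff)
  obtain j where j: "a' * u - 1 = int N * j" using u(2) by (auto simp: cong_iff_dvd_diff)
  have a'\<omega>: "of_int a' * \<omega>' \<in> R"
    unfolding \<omega>'_def R_form_basis[OF act(2)] by (rule int_mod.span_base) simp
  \<comment> \<open>Both terms on the right are multiples of \<open>N\<close> in the order: the
    first because \<open>N\<close> divides r and a' \<omega>' is integral, the second because a' u
    is congruent to 1.\<close>
  have "of_int (a' * u) * \<mu> - of_int s = of_int u * of_int r * (of_int a' * \<omega>') + of_int (a' * u - 1) * of_int s"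
    unfolding \<mu>_def of_int_mult of_int_diff of_int_1 by Groebner_Basis.algebra
  also have "\<dots> = of_nat N * (of_int u * of_int k * (of_int a' * \<omega>') + of_int j * of_int s)"
    unfolding k j of_int_mult of_int_of_nat_eq by Groebner_Basis.algebra
  finally have "of_int (a' * u) * \<mu> - of_int s
      = of_nat N * (of_int u * of_int k * (of_int a' * \<omega>') + of_int j * of_int s)" .
  moreover have "of_int u * of_int k * (of_int a' * \<omega>') + of_int j * of_int s \<in> R"
    by (intro R_add R_mult R_of_int a'\<omega>)
  ultimately have "cong_R (of_int (a' * u) * \<mu>) s" unfolding cong_R_def by blast
  moreover have "g s" using \<Gamma>_diagonal(2)[OF \<gamma>] by (simp add: rs)
  moreover have "g (a' * u)" using g_cong[OF g_1] u(2) by (simp add: cong_sym)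
  moreover have "a' * u > 0" using a' u(1) by simp
  moreover have "of_int (a' * u) * \<mu> \<noteq> 0" using \<mu> a' u(1) by simp
  ultimately have "principal_ideal R (of_int (a' * u) * \<mu> / of_int (a' * u)) \<in> PG"
    by (intro PGI)
  then have "principal_ideal R \<mu> \<in> PG" using a' u(1) by simp
  moreover have "proper (form_lattice D Q)"
    using form_lattice_in_level_ideals[OF Q] by (simp add: level_ideals_def)
  then have "ideal_times (principal_ideal R \<mu>) (form_lattice D Q) = principal_ideal (form_lattice D Q) \<mu>"
    by (intro ideal_times_principal properD)
  ultimately show ?thesis using L by auto
qed

text \<open>The homothety gives n = \<nu> (r \<omega>' + s) with \<nu> congruent to t. Multiplied by
  a' and compared in the basis a' \<omega>', 1 of the order, this yields t r = 0 and t s = n modulo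
  \<open>N\<close>. As t is a unit, r vanishes modulo \<open>N\<close>, and the residue of s, then
  that of p, lies in the subgroup.\<close>

lemma form_lattice_PG_imp_equivalent:
  assumes Q: "Q \<in> forms D N" and Q': "Q' \<in> forms D N" and P: "P \<in> PG"
    and eq: "form_lattice D Q = ideal_times P (form_lattice D Q')"
  shows "\<exists>\<gamma>\<in>\<Gamma>. Q' = form_act Q \<gamma>"
proof -
  obtain a b c where abc: "Q = (a, b, c)" by (cases Q)
  obtain a' b' c' where abc': "Q' = (a', b', c')" by (cases Q')
  obtain \<nu> n t where P: "P = principal_ideal R (\<nu> / of_int n)" "\<nu> \<noteq> 0" "n > 0" "g n" "g t" "cong_R \<nu> t"
    using P by (rule PGE)
  have "proper (form_lattice D Q')"
    using form_lattice_in_level_ideals[OF Q'] by (simp add: level_ideals_def)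
  then have "ideal_times P (form_lattice D Q') = principal_ideal (form_lattice D Q') (\<nu> / of_int n)"
    unfolding P(1) by (intro ideal_times_principal properD)
  with eq have "form_lattice D (a, b, c) = principal_ideal (form_lattice D (a', b', c')) (\<nu> / of_int n)"
    by (simp add: abc abc')
  with Q Q' obtain \<gamma> :: "int^2^2" where \<gamma>: "det \<gamma> = 1" "(a', b', c') = form_act (a, b, c) \<gamma>"
    "\<nu> / of_int n * (of_int (\<gamma>$2$1) * form_root D (a', b', c') + of_int (\<gamma>$2$2)) = 1"
    unfolding abc abc' by (rule homothetic_form_lattices)
  define \<omega>' where "\<omega>' = form_root D (a', b', c')"
  define p r s where prs: "p = \<gamma>$1$1" "r = \<gamma>$2$1" "s = \<gamma>$2$2"
  let ?\<theta> = "of_int a' * \<omega>'"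
  have n: "of_int n = \<nu> * (of_int r * \<omega>' + of_int s)"
    using \<gamma>(3) P(3) by (simp add: prs \<omega>'_def field_simps)
  obtain y where y: "y \<in> R" "\<nu> - of_int t = of_nat N * y" using P(6) by (auto simp: cong_R_def)
  have Q'': "(a', b', c') \<in> forms D N" using Q' by (simp add: abc')
  have R: "R = int_mod.span {?\<theta>, 1}" unfolding \<omega>'_def by (rule R_form_basis[OF Q''])
  have \<theta>: "?\<theta> \<in> R" unfolding R by (rule int_mod.span_base) simp
  then have "y * (of_int r * ?\<theta> + of_int a' * of_int s) \<in> R" using y \<theta> by (simp only: R_mult R_add R_of_int)
  then obtain k l where kl: "y * (of_int r * ?\<theta> + of_int a' * of_int s) = of_int k * ?\<theta> + of_int l"
    unfolding R span_pair_iff by auto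
  \<comment> \<open>The factor a' brings every term into the order, where coordinates are unique;
    being prime to \<open>N\<close>, it can be cancelled afterwards.\<close>
  have "of_int 0 * ?\<theta> + of_int (a' * n) = of_int a' * of_int n" by simp
  also have "\<dots> = \<nu> * (of_int r * ?\<theta> + of_int a' * of_int s)"
    unfolding n by Groebner_Basis.algebra
  also have "\<dots> = (of_int t + of_nat N * y) * (of_int r * ?\<theta> + of_int a' * of_int s)"
    by (simp flip: y(2))
  also have "\<dots> = of_int t * (of_int r * ?\<theta> + of_int a' * of_int s)
      + of_nat N * (y * (of_int r * ?\<theta> + of_int a' * of_int s))" by Groebner_Basis.algebra
  also have "\<dots> = of_int (t * r + int N * k) * ?\<theta> + of_int (a' * (t * s) + int N * l)"
    unfolding kl of_int_mult of_int_add of_int_of_nat_eq by Groebner_Basis.algebra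
  finally have "of_int 0 * ?\<theta> + of_int (a' * n)
      = of_int (t * r + int N * k) * ?\<theta> + of_int (a' * (t * s) + int N * l)" .
  moreover have "a' > 0" "coprime a' (int N)" using Q'' by (auto simp: forms_def coprime_iff_gcd_eq_1)
  have "Im ?\<theta> \<noteq> 0"
    using Im_form_root[OF Q''] \<open>a' > 0\<close> by (simp add: \<omega>'_def)
  ultimately have tr: "0 = t * r + int N * k" and an: "a' * n = a' * (t * s) + int N * l"
    using lattice_coords_unique by blast+
  have "t * r = int N * (- k)" using tr by simp
  then have "int N dvd t * r" by simp
  moreover have "coprime (int N) t" using g_coprime[OF P(5)] by (simp add: coprime_commute)
  ultimately have "int N dvd r" by (simp add: coprime_dvd_mult_right_iff)
  have "[a' * n = a' * (t * s)] (mod int N)" using an by (simp add: cong_iff_dvd_diff)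
  then have "[n = t * s] (mod int N)" using \<open>coprime a' (int N)\<close> by (simp add: cong_mult_lcancel)
  then have ts: "g (t * s)" using g_cong[OF P(4)] by blast
  obtain u where u: "g u" "[t * u = 1] (mod int N)" using g_inverse[OF P(5)] .
  have "[t * u * s = 1 * s] (mod int N)" using u(2) by (rule cong_scalar_right)
  then have "[u * (t * s) = s] (mod int N)" by (simp add: ac_simps)
  then have "g s" using g_cong[OF g_mult[OF u(1) ts]] by blast
  moreover have "[s * p = 1] (mod int N)"
  proof -
    have "s * p - 1 = \<gamma>$1$2 * r" using \<gamma>(1) by (simp add: det_2 prs mult.commute)
    then show ?thesis using \<open>int N dvd r\<close> by (simp add: cong_iff_dvd_diff)
  qed
  ultimately have "g p" by (rule g_inv)
  then have "\<gamma> \<in> \<Gamma>" using \<gamma>(1) \<open>int N dvd r\<close> by (simp add: \<Gamma>_def prs cong_0_iff)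
  then show ?thesis using \<gamma>(2) abc abc' by blast
qed

end


section \<open>Every class contains the lattice of a form\<close>

context quad_order_level
begin

text \<open>
  The second basis vector \<open>\<xi> = u l + N \<beta>\<close> is chosen to be congruent to 1 modulo \<open>N\<close>; it is
  primitive because \<open>u\<close> is prime to \<open>N\<close>.
\<close>

lemma level_ideal_basis:
  assumes A: "A \<in> level_ideals"
  obtains \<omega> \<xi> m where "Im \<omega> > 0" "\<xi> \<noteq> 0" "cong_R \<xi> 1" "m > 0" "[m = 1] (mod int N)"
    "A = principal_ideal (int_mod.span {\<omega>, 1}) (\<xi> / of_int m)"
proof -
  obtain m where m: "m > 0" "[m = 1] (mod int N)" "of_int m \<in> A" "\<forall>x\<in>A. of_int m * x \<in> R"
    using A by (rule level_idealsE)
  have "proper A" using A by (simp add: level_ideals_def)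
  \<comment> \<open>Scaling by \<open>m\<close> makes the ideal integral. It contains the integer
    m^2, which will force the integer basis vector \<open>l\<close> to be prime to
    \<open>N\<close>.\<close>
  define B where "B = principal_ideal A (of_int m)"
  have B_sub: "B \<subseteq> R" using m(4) by (auto simp: B_def mem_principal_ideal)
  have subB: "int_mod.subspace B"
    unfolding B_def by (rule principal_ideal_subspace[OF properD(2)[OF \<open>proper A\<close>]])
  have B_closed: "r * x \<in> B" if "r \<in> R" "x \<in> B" for r x
    using principal_ideal_closed[OF properD(3)[OF \<open>proper A\<close> that(1)]] that(2) unfolding B_def by blast
  have mmB: "of_int (m * m) \<in> B"
    unfolding B_def mem_principal_ideal using m(3) by auto
  have "\<exists>\<beta> l. B = int_mod.span {\<beta>, of_int l}"
    by (rule sublattice_basis[OF _ subB, of \<tau>]) (use Im_\<tau> B_sub R_eq in auto)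
  then obtain \<beta>0 l where \<beta>0: "B = int_mod.span {\<beta>0, of_int l}" by blast
  \<comment> \<open>Otherwise \<open>B\<close> would consist of real numbers, but it contains m^2
    \<tau>.\<close>
  have "Im \<beta>0 \<noteq> 0"
  proof
    assume 0: "Im \<beta>0 = 0"
    have "\<tau> * of_int (m * m) \<in> B" by (rule B_closed[OF \<tau>_in_R mmB])
    then obtain i j where "\<tau> * of_int (m * m) = of_int i * \<beta>0 + of_int j * of_int l"
      unfolding \<beta>0 span_pair_iff by blast
    then have "Im (\<tau> * of_int (m * m)) = Im (of_int i * \<beta>0 + of_int j * of_int l)" by (rule arg_cong)
    then show False using 0 Im_\<tau> m(1) by simp
  qed
  obtain i j where ij: "of_int (m * m) = of_int i * \<beta>0 + of_int j * of_int l"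
    using mmB unfolding \<beta>0 span_pair_iff by blast
  have "Im (of_int (m * m)) = Im (of_int i * \<beta>0 + of_int j * of_int l)"
    using ij by (rule arg_cong)
  then have "i = 0" using \<open>Im \<beta>0 \<noteq> 0\<close> by simp
  with ij have "of_int (m * m) = (of_int (j * l) :: complex)" by simp
  then have mm: "m * m = j * l" by (simp only: of_int_eq_iff)
  have "l \<noteq> 0" using mm m(1) by auto
  have "[l * j = 1] (mod int N)" using cong_mult[OF m(2,2)] by (simp add: mm mult.commute)
  then have "coprime l (int N)" using coprime_iff_invertible_int by blast
  \<comment> \<open>The sign of the first vector is chosen so that \<eta> / \<xi> will lie in the
    upper half-plane.\<close>
  obtain \<beta> where \<beta>: "B = int_mod.span {\<beta>, of_int l}" "of_int l * Im \<beta> > 0"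
  proof (cases "of_int l * Im \<beta>0 > 0")
    case True
    then show ?thesis using that \<beta>0 by blast
  next
    case False
    have "of_int l * Im (- \<beta>0) \<noteq> 0" using \<open>l \<noteq> 0\<close> \<open>Im \<beta>0 \<noteq> 0\<close> by simp
    then have "of_int l * Im (- \<beta>0) > 0" using False by (simp add: less_le)
    then show ?thesis using that[of "- \<beta>0"] \<beta>0 by (simp add: span_uminus_left)
  qed
  obtain u where u: "[l * u = 1] (mod int N)"
    using cong_solve_coprime_int[OF \<open>coprime l (int N)\<close>] by blast
  then have "[u * l = 1] (mod int N)" by (simp add: mult.commute)
  then have "coprime u (int N)" using coprime_iff_invertible_int by blast
  \<comment> \<open>The Bezout coefficients complete the row (N, u) by the row (x, -y) to a matrix
    of determinant 1.\<close>
  then obtain x y where xy: "x * u + y * int N = 1"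
    using bezout_int[of u "int N"] by (auto simp: coprime_iff_gcd_eq_1)
  define \<xi> where "\<xi> = of_int (int N) * \<beta> + of_int u * of_int l"
  define \<eta> where "\<eta> = of_int x * \<beta> + of_int (- y) * of_int l"
  have det: "x * u - (- y) * int N = 1" using xy by simp
  have span: "int_mod.span {\<eta>, \<xi>} = B"
    unfolding \<eta>_def \<xi>_def \<beta>(1) by (rule span_unimodular[OF det])
  have "Im (\<eta> * cnj \<xi>) = of_int (x * u - (- y) * int N) * Im (\<beta> * cnj (of_int l))"
    unfolding \<eta>_def \<xi>_def by (rule Im_basis_change)
  also have "\<dots> > 0" unfolding det using \<beta>(2) by (simp add: mult.commute)
  finally have Im: "Im (\<eta> * cnj \<xi>) > 0" .
  then have "\<xi> \<noteq> 0" by auto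
  have "Im (\<eta> / \<xi>) > 0" using Im by (simp add: Im_complex_div_gt_0)
  moreover note \<open>\<xi> \<noteq> 0\<close>
  moreover have "cong_R \<xi> 1"
  proof -
    obtain k where k: "l * u - 1 = int N * k" using u by (auto simp: cong_iff_dvd_diff)
    have "\<xi> - of_int 1 = of_nat N * \<beta> + of_int (l * u - 1)"
      unfolding \<xi>_def of_int_mult of_int_diff of_int_1 of_int_of_nat_eq by Groebner_Basis.algebra
    also have "\<dots> = of_nat N * (\<beta> + of_int k)"
      unfolding k of_int_mult of_int_of_nat_eq by Groebner_Basis.algebra
    finally have "\<xi> - of_int 1 = of_nat N * (\<beta> + of_int k)" .
    moreover have "\<beta> \<in> B" unfolding \<beta>(1) by (rule int_mod.span_base) simp
    then have "\<beta> + of_int k \<in> R" using B_sub by (intro R_add) auto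
    ultimately show ?thesis unfolding cong_R_def by blast
  qed
  moreover note m(1,2)
  moreover have "A = principal_ideal (int_mod.span {\<eta> / \<xi>, 1}) (\<xi> / of_int m)"
  proof -
    have "A = principal_ideal B (1 / of_int m)"
      using m(1) by (simp add: B_def principal_ideal_principal_ideal)
    also have "B = principal_ideal (int_mod.span {\<eta> / \<xi>, 1}) \<xi>"
      using \<open>\<xi> \<noteq> 0\<close> span by (simp add: principal_ideal_span_pair)
    finally show ?thesis by (simp add: principal_ideal_principal_ideal)
  qed
  ultimately show ?thesis by (rule that)
qed

end

context unit_level
begin

text \<open>Dividing \<open>A\<close> by \<xi> / m leaves [\<omega>, 1] in
  \<open>I(\<O>, N)\<close>, so \<open>lattice_form\<close> supplies a primitive form. It remains to
  see that its a is prime to \<open>N\<close>: some n congruent to 1 satisfies n \<omega> \<in> \<O>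
  = [a \<omega>, 1], so a divides n.\<close>

lemma class_contains_form:
  assumes A: "A \<in> level_ideals"
  shows "\<exists>Q\<in>forms D N. \<exists>P\<in>PG. A = ideal_times P (form_lattice D Q)"
proof -
  obtain \<omega> \<xi> m where *: "Im \<omega> > 0" "\<xi> \<noteq> 0" "cong_R \<xi> 1" "m > 0" "[m = 1] (mod int N)"
    "A = principal_ideal (int_mod.span {\<omega>, 1}) (\<xi> / of_int m)"
    using A by (rule level_ideal_basis)
  let ?L = "int_mod.span {\<omega>, 1}" and ?P = "principal_ideal R (\<xi> / of_int m)"
  have "g m" using g_cong[OF g_1] *(5) by (simp add: cong_sym)
  then have P: "?P \<in> PG" using *(2-4) g_1 by (intro PGI)
  then have PL: "?P \<in> level_ideals" using PG_subset by blast
  have "proper A" using A by (simp add: level_ideals_def)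
  let ?\<kappa> = "\<xi> / of_int m"
  have \<kappa>: "?\<kappa> \<in> K" "?\<kappa> \<noteq> 0" using *(2-4) cong_R_mem K_divide_int by auto
  have inv: "principal_ideal R (inverse ?\<kappa>) \<in> level_ideals"
    by (rule principal_inverse_in_level_ideals[OF PL \<kappa>])
  have "ideal_times (principal_ideal R (inverse ?\<kappa>)) A = principal_ideal A (inverse ?\<kappa>)"
    by (intro ideal_times_principal properD[OF \<open>proper A\<close>])
  also have "\<dots> = ?L" using \<kappa>(2) *(6) by (simp add: principal_ideal_principal_ideal)
  finally have L: "?L \<in> level_ideals" using level_ideals_times[OF inv A] by simp
  then have "proper ?L" by (simp add: level_ideals_def)
  then obtain a b c where Q: "gcd a (gcd b c) = 1" "a > 0" "b\<^sup>2 - 4 * a * c = D"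
    "\<omega> = form_root D (a, b, c)" "R = int_mod.span {of_int a * \<omega>, 1}"
    using *(1) by (rule lattice_form)
  have "gcd a (int N) = 1"
  proof -
    obtain n where n: "[n = 1] (mod int N)" "\<forall>x\<in>?L. of_int n * x \<in> R"
      using L by (rule level_idealsE)
    have "of_int n * \<omega> \<in> R" using n(2) int_mod.span_base[of \<omega> "{\<omega>, 1}"] by simp
    then obtain i j where "of_int n * \<omega> = of_int i * (of_int a * \<omega>) + of_int j * 1"
      unfolding Q(5) span_pair_iff by blast
    then have eq: "of_int n * \<omega> + of_int 0 = of_int (i * a) * \<omega> + of_int j"
      by (simp only: of_int_mult of_int_0 mult.assoc mult_1_right add_0_right)
    have "Im \<omega> \<noteq> 0" using *(1) by simp
    from lattice_coords_unique(1)[OF this eq] have "n = i * a" .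
    then have "[a * i = 1] (mod int N)" using n(1) by (simp add: mult.commute)
    then have "coprime a (int N)" using coprime_iff_invertible_int by blast
    then show ?thesis by (simp only: coprime_iff_gcd_eq_1)
  qed
  then have "(a, b, c) \<in> forms D N" using Q by (simp add: forms_def)
  moreover have "ideal_times ?P ?L = A"
    unfolding *(6) by (intro ideal_times_principal properD[OF \<open>proper ?L\<close>])
  then have "A = ideal_times ?P (form_lattice D (a, b, c))" by (simp add: form_lattice_def Q(4))
  ultimately show ?thesis using P by blast
qed

section \<open>The bijection and the induced form class group\<close>

lemma psi_bijective:
  "psi_well_defined_bij K R N \<Gamma> PG"
proof -
  interpret comm_group \<I> by (rule comm_group_level)
  let ?f = "form_ideal_class K R N PG"
  have f: "?f Q = PG #>\<^bsub>\<I>\<^esub> form_lattice D Q" for Q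
    by (simp add: form_ideal_class_def order_discriminant_R)
  have eq_iff: "?f Q = ?f Q' \<longleftrightarrow> (\<exists>P\<in>PG. form_lattice D Q' = ideal_times P (form_lattice D Q))"
    if "Q \<in> forms D N" "Q' \<in> forms D N" for Q Q'
    unfolding f using that by (subst r_coset_eq_iff[OF subgroup_PG]) (auto intro: form_lattice_in_level_ideals)
  have equiv: "equiv (forms D N) (form_rel D N \<Gamma>)" by (rule equiv_form_rel[OF subgroup_\<Gamma>])
  have resp: "?f respects form_rel D N \<Gamma>"
  proof (rule congruentI)
    fix Q Q' assume "(Q, Q') \<in> form_rel D N \<Gamma>"
    then obtain \<gamma> where *: "Q \<in> forms D N" "Q' \<in> forms D N" "\<gamma> \<in> \<Gamma>" "Q' = form_act Q \<gamma>"
      by (auto simp: form_rel_def)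
    then show "?f Q = ?f Q'"
      unfolding eq_iff[OF *(1,2)] using form_lattice_act_PG[of Q \<gamma>] by simp
  qed
  \<comment> \<open>The equality of cosets is used with Q and Q' exchanged, because
    \<open>form_lattice_PG_imp_equivalent\<close> expresses the lattice of Q through that of
    Q'.\<close>
  have inj: "(Q, Q') \<in> form_rel D N \<Gamma>" if Q: "Q \<in> forms D N" "Q' \<in> forms D N" "?f Q = ?f Q'" for Q Q'
  proof -
    obtain P where "P \<in> PG" "form_lattice D Q = ideal_times P (form_lattice D Q')"
      using eq_iff[OF Q(2,1)] Q(3) by auto
    then show ?thesis
      using form_lattice_PG_imp_equivalent[OF Q(1,2)] Q(1,2) by (auto simp: form_rel_def)
  qed
  have surj: "?f ` forms D N = carrier (\<I> Mod PG)"
  proof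
    show "?f ` forms D N \<subseteq> carrier (\<I> Mod PG)"
      using form_lattice_in_level_ideals by (auto simp: f FactGroup_def RCOSETS_def)
    show "carrier (\<I> Mod PG) \<subseteq> ?f ` forms D N"
    proof
      fix C assume "C \<in> carrier (\<I> Mod PG)"
      then obtain A where A: "A \<in> level_ideals" "C = PG #>\<^bsub>\<I>\<^esub> A"
        by (auto simp: FactGroup_def RCOSETS_def)
      obtain Q P where "Q \<in> forms D N" "P \<in> PG" "A = ideal_times P (form_lattice D Q)"
        using class_contains_form[OF A(1)] by blast
      then have "PG #>\<^bsub>\<I>\<^esub> form_lattice D Q = PG #>\<^bsub>\<I>\<^esub> A"
        using A(1) by (subst r_coset_eq_iff[OF subgroup_PG]) (auto intro: form_lattice_in_level_ideals)
      then show "C \<in> ?f ` forms D N" using A(2) f \<open>Q \<in> forms D N\<close> by auto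
    qed
  qed
  have psi: "psi K R N PG = (\<lambda>C. the_elem (?f ` C))" by (simp add: psi_def fun_eq_iff)
  show ?thesis
    unfolding psi_well_defined_bij_def Let_def order_discriminant_R form_classes_def psi
  proof (intro conjI)
    show "PG \<lhd> \<I>" by (rule subgroup_imp_normal[OF subgroup_PG])
    show "\<forall>Q\<in>forms D N. form_lattice D Q \<in> carrier \<I>" by (simp add: form_lattice_in_level_ideals)
    show "bij_betw (\<lambda>C. the_elem (?f ` C)) (forms D N // form_rel D N \<Gamma>) (carrier (\<I> Mod PG))"
      by (rule bij_betw_quotient[OF equiv resp inj surj])
  qed (rule equiv resp is_group)+
qed

lemma PG_induces:
  "Gamma1 N \<subseteq> \<Gamma>" "subgroup PG (\<I>\<lparr>carrier := principal_prime_to K R N\<rparr>)"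
proof -
  show "Gamma1 N \<subseteq> \<Gamma>"
    using g_cong[OF g_1] by (auto simp: Gamma1_def \<Gamma>_def cong_sym)
  interpret comm_group \<I> by (rule comm_group_level)
  let ?S = "{principal_ideal R \<nu> | \<nu>. \<nu> \<in> R - {0} \<and> (\<exists>t. g t \<and> (\<exists>y\<in>R. \<nu> - of_int t = of_nat N * y))}"
  let ?T = "{principal_ideal R \<nu> | \<nu>. \<nu> \<in> R - {0} \<and> prime_to R N (principal_ideal R \<nu>)}"
  \<comment> \<open>An element with residue in the subgroup is a unit modulo \<open>N\<close>, so
    every generator of \<open>P\<^sub>G(\<O>, N)\<close> is one of
    \<open>P(\<O>, N)\<close>.\<close>
  have "?S \<subseteq> ?T" using principal_cong(2) unfolding cong_R_def by blast
  from mono_generate[OF this] have sub: "PG \<subseteq> principal_prime_to K R N"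
    unfolding generate_PG principal_prime_to_def .
  have "?T \<subseteq> carrier \<I>"
  proof
    fix A assume "A \<in> ?T"
    then obtain \<nu> where \<nu>: "A = principal_ideal R \<nu>" "\<nu> \<in> R" "\<nu> \<noteq> 0" "prime_to R N A" by blast
    have "proper A" unfolding \<nu>(1) using \<nu>(2,3) R_subset_K by (intro proper_principal) auto
    moreover have "A \<subseteq> R" using \<nu>(2) by (auto simp: \<nu>(1) mem_principal_ideal R_mult)
    ultimately show "A \<in> carrier \<I>" using integral_prime_to_in_level_ideals \<nu>(4) by simp
  qed
  then have "subgroup (principal_prime_to K R N) \<I>"
    unfolding principal_prime_to_def by (rule generate_is_subgroup)
  then show "subgroup PG (\<I>\<lparr>carrier := principal_prime_to K R N\<rparr>)"
    using subgroup_incl[OF subgroup_PG _ sub] by blast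
qed

end

section \<open>Orders of imaginary quadratic fields\<close>

lemma rat_quotient:
  fixes q :: rat
  obtains a b where "b > 0" "q = of_int a / of_int b"
  using that by (cases q) (simp add: Fract_of_int_quotient)

lemma of_rat_in_Reals: "(of_rat q :: complex) \<in> \<real>"
  by (rule rat_quotient[of q]) (simp add: of_rat_divide)

lemma rat_span_pair_denominator:
  assumes "x \<in> rat_vs.span {\<theta>, 1}"
  obtains d where "d > 0" "of_int d * x \<in> int_mod.span {\<theta>, 1}"
proof -
  obtain u v where x: "x = of_rat u * \<theta> + of_rat v"
    using assms unfolding rat_vs.span_breakdown_eq rat_vs.span_empty by (force simp: algebra_simps)
  obtain a b where u: "b > 0" "u = of_int a / of_int b" by (rule rat_quotient)
  obtain a' b' where v: "b' > 0" "v = of_int a' / of_int b'" by (rule rat_quotient)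
  have "of_int (b * b') * x = of_int (a * b') * \<theta> + of_int (a' * b) * 1"
    using u(1) v(1) by (simp add: x u(2) v(2) of_rat_divide distrib_left)
  then have "of_int (b * b') * x \<in> int_mod.span {\<theta>, 1}" by (metis span_pairI)
  then show ?thesis using that[of "b * b'"] u(1) v(1) by simp
qed

lemma common_denominator:
  assumes "finite S" "\<And>x. x \<in> S \<Longrightarrow> \<exists>d>0. of_int d * x \<in> L" "int_mod.subspace L"
  shows "\<exists>d>0. \<forall>x\<in>S. of_int d * x \<in> L"
  using assms(1,2)
proof (induction S)
  case empty
  then show ?case by (auto intro: exI[of _ 1])
next
  case (insert x S)
  have "\<exists>d>0. \<forall>x\<in>S. of_int d * x \<in> L" using insert by simp
  then obtain d where d: "d > 0" "\<forall>x\<in>S. of_int d * x \<in> L" by blast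
  have "\<exists>e>0. of_int e * x \<in> L" using insert.prems by simp
  then obtain e where e: "e > 0" "of_int e * x \<in> L" by blast
  have "of_int (d * e) * y \<in> L" if "y \<in> insert x S" for y
  proof (cases "y = x")
    case True
    then show ?thesis
      using int_mod.subspace_scale[OF assms(3) e(2), of d] by (simp only: of_int_mult mult.assoc)
  next
    case False
    then have "of_int d * y \<in> L" using that d(2) by simp
    then show ?thesis
      using int_mod.subspace_scale[OF assms(3), of "of_int d * y" e]
      by (simp only: of_int_mult mult.assoc mult.left_commute[of "of_int d"])
  qed
  then show ?case using d(1) e(1) by (intro exI[of _ "d * e"]) auto
qed

text \<open>Rational multiples of 1 are real, so \<theta> and 1 are independent; a third independent
  vector would contradict dimension 2.\<close>

lemma quadratic_field_span:
  assumes K: "imaginary_quadratic_field K" and \<theta>: "\<theta> \<in> K" "1 \<in> K" "Im \<theta> \<noteq> 0"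
  shows "K \<subseteq> rat_vs.span {\<theta>, 1}"
proof
  fix x assume x: "x \<in> K"
  obtain B where B: "B \<subseteq> K" "K \<subseteq> rat_vs.span B" "card B = rat_vs.dim K"
    using rat_vs.basis_exists by metis
  then have card: "card B = 2" using K by (simp add: imaginary_quadratic_field_def)
  then have fin: "finite B" by (metis card.infinite zero_neq_numeral)
  have real: "Im z = 0" if "z \<in> rat_vs.span {1}" for z
    using that of_rat_in_Reals unfolding rat_vs.span_singleton by (auto simp: complex_is_Real_iff)
  have "rat_vs.independent {1}"
    by (simp add: rat_vs.independent_insert rat_vs.independent_empty)
  moreover have "\<theta> \<notin> rat_vs.span {1}" using real \<theta>(3) by blast
  ultimately have ind: "rat_vs.independent {\<theta>, 1}" by (simp add: rat_vs.independent_insertI)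
  show "x \<in> rat_vs.span {\<theta>, 1}"
  proof (rule ccontr)
    assume 1: "x \<notin> rat_vs.span {\<theta>, 1}"
    then have "rat_vs.independent {x, \<theta>, 1}" using ind by (rule rat_vs.independent_insertI)
    moreover have "{x, \<theta>, 1} \<subseteq> rat_vs.span B" using x \<theta> B(2) by auto
    ultimately have "card {x, \<theta>, 1} \<le> 2"
      using rat_vs.independent_span_bound[OF fin] card by metis
    moreover have "x \<notin> {\<theta>, 1}" using 1 rat_vs.span_base[of x "{\<theta>, 1}"] by blast
    moreover have "\<theta> \<noteq> 1" using \<theta>(3) by auto
    ultimately show False by simp
  qed
qed

text \<open>A common denominator d puts d R inside [\<theta>, 1], and the normal form of sublattices
  gives R = [\<beta>, e] with e rational. Since R contains 1 and e^2, there are integers j and n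
  with j e = 1 and e = n, so e is 1 or -1.\<close>

lemma order_basis:
  assumes K: "imaginary_quadratic_field K" and R: "is_order K R"
  obtains \<tau> where "Im \<tau> > 0" "R = int_mod.span {\<tau>, 1}"
proof -
  have sub: "subring R complex_ring" and RK: "R \<subseteq> K" and span: "rat_vs.span R = K"
    using R by (auto simp: is_order_def)
  obtain S where S: "finite S" "R = int_mod.span S" using R by (auto simp: is_order_def)
  have R1: "1 \<in> R" using subringE(3)[OF sub] by (simp add: ring_of_type_algebra_def)
  have Rm: "x * y \<in> R" if "x \<in> R" "y \<in> R" for x y
    using subringE(6)[OF sub that] by (simp add: ring_of_type_algebra_def)
  \<comment> \<open>A real order would have a real rational span, but that span is
    \<open>K\<close>.\<close>
  have "\<exists>\<theta>\<in>R. Im \<theta> \<noteq> 0"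
  proof (rule ccontr)
    assume "\<not> (\<exists>\<theta>\<in>R. Im \<theta> \<noteq> 0)"
    then have "R \<subseteq> \<real>" by (auto simp: complex_is_Real_iff)
    moreover have "rat_vs.subspace \<real>" by (auto simp: rat_vs.subspace_def intro: Reals_mult of_rat_in_Reals)
    ultimately have "K \<subseteq> \<real>" unfolding span[symmetric] by (rule rat_vs.span_minimal)
    then show False using K by (simp add: imaginary_quadratic_field_def)
  qed
  then obtain \<theta> where \<theta>: "\<theta> \<in> R" "Im \<theta> \<noteq> 0" by blast
  have den: "\<exists>d>0. of_int d * x \<in> int_mod.span {\<theta>, 1}" if "x \<in> S" for x
  proof -
    have "x \<in> K" using that S(2) RK int_mod.span_base by blast
    then have "x \<in> rat_vs.span {\<theta>, 1}" using quadratic_field_span[OF K, of \<theta>] \<theta> R1 RK by blast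
    then show ?thesis using rat_span_pair_denominator by metis
  qed
  obtain d where d: "d > 0" "\<forall>x\<in>S. of_int d * x \<in> int_mod.span {\<theta>, 1}"
    using common_denominator[OF S(1) den] by auto
  have "R \<subseteq> {x. of_int d * x \<in> int_mod.span {\<theta>, 1}}"
    unfolding S(2) using d(2) by (intro int_mod.span_minimal subspace_mult_preimage) auto
  then have "principal_ideal R (of_int d) \<subseteq> int_mod.span {\<theta>, 1}"
    by (auto simp: mem_principal_ideal)
  moreover have "int_mod.subspace (principal_ideal R (of_int d))"
    unfolding S(2) by (rule principal_ideal_subspace) simp
  ultimately obtain \<beta>0 l where "principal_ideal R (of_int d) = int_mod.span {\<beta>0, of_int l}"
    using sublattice_basis[OF \<theta>(2)] by meson
  then have "principal_ideal (principal_ideal R (of_int d)) (1 / of_int d)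
      = int_mod.span {1 / of_int d * \<beta>0, 1 / of_int d * of_int l}"
    by (simp only: principal_ideal_span_pair)
  moreover define \<beta> e where "\<beta> = 1 / of_int d * \<beta>0" and "e = 1 / of_int d * (of_int l :: complex)"
  ultimately have Re: "R = int_mod.span {\<beta>, e}"
    using d(1) by (simp add: principal_ideal_principal_ideal)
  have e0: "Im e = 0" by (simp add: e_def)
  have \<beta>0: "Im \<beta> \<noteq> 0"
  proof
    assume 0: "Im \<beta> = 0"
    obtain i j where "\<theta> = of_int i * \<beta> + of_int j * e" using \<theta>(1) unfolding Re span_pair_iff by blast
    then show False using 0 e0 \<theta>(2) by simp
  qed
  obtain i j where ij: "1 = of_int i * \<beta> + of_int j * e" using R1 unfolding Re span_pair_iff by blast
  have "Im (of_int i * \<beta> + of_int j * e) = 0" unfolding ij[symmetric] by simp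
  then have "i = 0" using e0 \<beta>0 by simp
  then have je: "of_int j * e = 1" using ij by simp
  have "e * e \<in> R" unfolding Re by (rule Rm[unfolded Re]) (auto intro: int_mod.span_base)
  then obtain k n where kn: "e * e = of_int k * \<beta> + of_int n * e" unfolding Re span_pair_iff by blast
  have "Im (of_int k * \<beta> + of_int n * e) = 0" unfolding kn[symmetric] using e0 by simp
  then have "k = 0" using e0 \<beta>0 by simp
  then have "e * e = of_int n * e" using kn by simp
  moreover have "e \<noteq> 0" using je by auto
  ultimately have en: "e = of_int n" by simp
  then have "of_int (j * n) = (of_int 1 :: complex)" using je by simp
  then have "j * n = 1" by (simp only: of_int_eq_iff)
  then have "n = 1 \<or> n = -1" by (metis mult.commute zmult_eq_1_iff)
  moreover have "int_mod.span {\<beta>, -1} = int_mod.span {\<beta>, 1}"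
    using span_uminus_left[of 1 \<beta>] by (simp only: insert_commute[of \<beta>])
  ultimately have "R = int_mod.span {\<beta>, 1}"
    unfolding Re en by (elim disjE) (simp_all only: of_int_1 of_int_minus)
  then show ?thesis
    using that[of \<beta>] that[of "- \<beta>"] \<beta>0 span_uminus_left[of \<beta> 1] by (cases "Im \<beta> > 0") auto
qed

text \<open>Quotients of elements of the order by positive integers form a rational subspace between
  the order and its rational span, so they make up \<open>K\<close>. The quadratic equation is the
  expansion of \<tau>^2 in the basis.\<close>

lemma imaginary_quadratic_order:
  assumes K: "imaginary_quadratic_field K" and R: "is_order K R"
  obtains \<tau> T M where "quad_order K R \<tau> T M"
proof -
  obtain \<tau> where \<tau>: "Im \<tau> > 0" "R = int_mod.span {\<tau>, 1}" using order_basis[OF K R] .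
  have sub: "subring R complex_ring" and span: "rat_vs.span R = K"
    using R by (auto simp: is_order_def)
  have "\<tau> \<in> R" by (auto simp: \<tau>(2) intro: int_mod.span_base)
  then have "\<tau> * \<tau> \<in> R"
    using subringE(6)[OF sub] by (simp add: ring_of_type_algebra_def)
  then obtain i j where "\<tau> * \<tau> = of_int i * \<tau> + of_int j * 1"
    unfolding \<tau>(2) span_pair_iff by blast
  then have sq: "\<tau>\<^sup>2 = of_int i * \<tau> - of_int (- j)" by (simp add: power2_eq_square)
  let ?F = "{x / of_int n | x n. x \<in> R \<and> n > 0}"
  have Rs: "int_mod.subspace R" by (simp add: \<tau>(2))
  have "K = ?F"
  proof
    have FI: "x / of_int n \<in> ?F" if "x \<in> R" "n > 0" for x n using that by blast
    have "rat_vs.subspace ?F"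
    proof (rule rat_vs.subspaceI)
      show "0 \<in> ?F" using FI[OF int_mod.subspace_0[OF Rs], of 1] by simp
      fix z w assume z: "z \<in> ?F"
      then obtain x n where x: "z = x / of_int n" "x \<in> R" "n > 0" by blast
      show "of_rat q * z \<in> ?F" for q
      proof -
        obtain a b where q: "b > 0" "q = of_int a / of_int b" by (rule rat_quotient)
        have "of_int a * x / of_int (b * n) \<in> ?F"
          using q(1) x by (intro FI int_mod.subspace_scale[OF Rs]) auto
        then show ?thesis by (simp add: q(2) x(1) of_rat_divide)
      qed
      assume "w \<in> ?F"
      then obtain y m where y: "w = y / of_int m" "y \<in> R" "m > 0" by blast
      have "(of_int m * x + of_int n * y) / of_int (n * m) \<in> ?F"
        using x y by (intro FI int_mod.subspace_add[OF Rs] int_mod.subspace_scale[OF Rs]) auto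
      moreover have "z + w = (of_int m * x + of_int n * y) / of_int (n * m)"
        using x(3) y(3) by (simp add: x(1) y(1) add_frac_eq mult.commute)
      ultimately show "z + w \<in> ?F" by simp
    qed
    moreover have "R \<subseteq> ?F" using FI[of _ 1] by auto
    ultimately show "K \<subseteq> ?F" unfolding span[symmetric] by (intro rat_vs.span_minimal)
    show "?F \<subseteq> K"
    proof
      fix z assume "z \<in> ?F"
      then obtain x n where x: "z = x / of_int n" "x \<in> R" "n > 0" by blast
      then have "z = of_rat (1 / of_int n) * x" by (simp add: of_rat_divide)
      then show "z \<in> K" using rat_vs.span_scale[OF rat_vs.span_base[OF x(2)]] span by simp
    qed
  qed
  with \<tau> sq have "quad_order K R \<tau> i (- j)" by (simp add: quad_order_def)
  then show ?thesis by (rule that)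
qed


section \<open>Residue classes\<close>

lemma residue_class_eq: "residue_class N t = {x. [x = t] (mod int N)}"
  unfolding residue_class_def a_r_coset_def' int_Idl
proof -
  have "x \<in> (\<Union>h\<in>{k * int N |k. True}. {h + t}) \<longleftrightarrow> (\<exists>k. x - t = int N * k)" for x
    by (auto simp: mult.commute diff_eq_eq)
  then show "(\<Union>h\<in>{k * int N |k. True}. {h \<oplus>\<^bsub>\<Z>\<^esub> t}) = {x. [x = t] (mod int N)}"
    unfolding int_add_eq cong_iff_dvd_diff dvd_def by blast
qed

lemma residue_class_eq_iff: "residue_class N s = residue_class N t \<longleftrightarrow> [s = t] (mod int N)"
proof
  assume "residue_class N s = residue_class N t"
  moreover have "s \<in> residue_class N s" by (simp add: residue_class_eq)
  ultimately have "s \<in> residue_class N t" by simp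
  then show "[s = t] (mod int N)" by (simp add: residue_class_eq)
next
  assume "[s = t] (mod int N)"
  then show "residue_class N s = residue_class N t" by (simp add: residue_class_eq cong_def)
qed

lemma residue_class_hom: "residue_class N \<in> ring_hom \<Z> (ZFact (int N))"
proof -
  have "ideal (Idl\<^bsub>\<Z>\<^esub> {int N}) \<Z>" by (simp add: int.genideal_ideal)
  from ideal.rcos_ring_hom[OF this] show ?thesis
    by (simp add: ZFact_def residue_class_def[abs_def])
qed

lemma residue_class_mult:
  "residue_class N s \<otimes>\<^bsub>ZFact (int N)\<^esub> residue_class N t = residue_class N (s * t)"
  using ring_hom_mult[OF residue_class_hom, of s t] by simp

lemma residue_class_one: "\<one>\<^bsub>ZFact (int N)\<^esub> = residue_class N 1"
  using ring_hom_one[OF residue_class_hom] by simp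

lemma residue_class_surj: "C \<in> carrier (ZFact (int N)) \<Longrightarrow> \<exists>t. C = residue_class N t"
  by (auto simp: ZFact_defs A_RCOSETS_def RCOSETS_def residue_class_def a_r_coset_def)

text \<open>The group inverse of the class of s is again a residue class, by surjectivity of the
  residue map. An integer u representing it shows that s is prime to \<open>N\<close>, and any t
  with s t congruent to 1 agrees with u modulo \<open>N\<close>.\<close>

lemma unit_level_residue_class:
  assumes q: "quad_order K R \<tau> T M" and N: "N > 0" and G: "subgroup G (units_of (ZFact (int N)))"
  shows "unit_level K R \<tau> T M N (\<lambda>t. residue_class N t \<in> G)"
proof -
  let ?g = "\<lambda>t. residue_class N t \<in> G" and ?Z = "ZFact (int N)"
  have grp: "group (units_of ?Z)"
    using ZFact_is_cring[of "int N"] by (intro monoid.units_group) (simp add: cring_def ring_def)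
  have inv: "\<exists>u. ?g u \<and> [s * u = 1] (mod int N)" if s: "?g s" for s
  proof -
    define U where "U = inv\<^bsub>units_of ?Z\<^esub> (residue_class N s)"
    have "U \<in> G" unfolding U_def by (rule subgroup.m_inv_closed[OF G s])
    then have "U \<in> carrier ?Z" using subgroup.mem_carrier[OF G] by (auto simp: units_of_def Units_def)
    then obtain u where u: "U = residue_class N u" using residue_class_surj by blast
    have "residue_class N s \<otimes>\<^bsub>units_of ?Z\<^esub> U = \<one>\<^bsub>units_of ?Z\<^esub>"
      unfolding U_def by (rule group.r_inv[OF grp subgroup.mem_carrier[OF G s]])
    then have "residue_class N (s * u) = residue_class N 1"
      by (simp add: units_of_def u residue_class_mult residue_class_one)
    then show ?thesis using \<open>U \<in> G\<close> u by (auto simp: residue_class_eq_iff)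
  qed
  have cong: "?g t" if "?g s" "[s = t] (mod int N)" for s t
    using that residue_class_eq_iff by metis
  show ?thesis
  proof (intro unit_level.intro unit_level_axioms.intro quad_order_level.intro quad_order_level_axioms.intro q N)
    show "?g 1"
      using subgroup.one_closed[OF G] by (simp add: units_of_def residue_class_one)
    show "?g (s * t)" if "?g s" "?g t" for s t
      using subgroup.m_closed[OF G that] by (simp add: units_of_def residue_class_mult)
    show "?g t" if "?g s" "[s = t] (mod int N)" for s t using that by (rule cong)
    show "coprime s (int N)" if "?g s" for s
      using inv[OF that] coprime_iff_invertible_int by blast
    show "?g t" if s: "?g s" and st: "[s * t = 1] (mod int N)" for s t
    proof -
      obtain u where u: "?g u" "[s * u = 1] (mod int N)" using inv[OF s] by blast
      have "[u * (s * t) = u * 1] (mod int N)" using st by (rule cong_scalar_left)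
      moreover have "[(s * u) * t = 1 * t] (mod int N)" using u(2) by (rule cong_scalar_right)
      ultimately have "[u = t] (mod int N)"
        by (metis cong_sym cong_trans mult.assoc mult.commute mult_1)
      with u(1) show ?thesis by (rule cong)
    qed
  qed
qed

theorem theorem1:
  fixes K \<O> :: "complex set" and N :: nat and G :: "int set set"
  assumes "imaginary_quadratic_field K"
    and "is_order K \<O>"
    and "N > 0"
    and "subgroup G (units_of (ZFact (int N)))"
  shows "psi_well_defined_bij K \<O> N (Gamma_in N G) (principal_in K \<O> N G) \<and>
         induces_form_class_group K \<O> N (Gamma_in N G)"
proof -
  obtain \<tau> T M where "quad_order K \<O> \<tau> T M"
    using imaginary_quadratic_order[OF assms(1,2)] .
  then interpret unit_level K \<O> \<tau> T M N "\<lambda>t. residue_class N t \<in> G"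
    by (rule unit_level_residue_class[OF _ assms(3,4)])
  interpret comm_group \<I> by (rule comm_group_level)
  have \<Gamma>: "Gamma_in N G = \<Gamma>"
  proof (intro equalityI subsetI)
    fix \<gamma> :: "int^2^2" assume "\<gamma> \<in> Gamma_in N G"
    then obtain t where t: "det \<gamma> = 1" "residue_class N t \<in> G" "[\<gamma>$1$1 = t] (mod int N)" "[\<gamma>$2$1 = 0] (mod int N)"
      by (auto simp: Gamma_in_def)
    then have "residue_class N (\<gamma>$1$1) \<in> G" using g_cong[OF t(2)] by (simp add: cong_sym)
    then show "\<gamma> \<in> \<Gamma>" using t by (simp add: \<Gamma>_def)
  next
    fix \<gamma> :: "int^2^2" assume "\<gamma> \<in> \<Gamma>"
    then show "\<gamma> \<in> Gamma_in N G" by (auto simp: Gamma_in_def \<Gamma>_def intro: exI[of _ "\<gamma>$1$1"])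
  qed
  have P: "principal_in K \<O> N G = PG" unfolding principal_in_def by (rule generate_PG)
  have "principal_in K \<O> N {residue_class N 1} \<subseteq> principal_in K \<O> N G"
  proof -
    have "{residue_class N 1} \<subseteq> G" using g_1 by simp
    then show ?thesis unfolding principal_in_def by (intro mono_generate) blast
  qed
  \<comment> \<open>The witness for \<open>P\<close> in \<open>induces_form_class_group\<close> is
    \<open>P\<^sub>G(\<O>, N)\<close> itself.\<close>
  then show ?thesis
    using psi_bijective PG_induces subgroup_\<Gamma>
    unfolding induces_form_class_group_def \<Gamma> P by blast
qed

end
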